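(* For every matrix algebra $\Lambda\subset k^{n\times n}$ (a subspace closed under multiplication and containing $I_n$), there exists a nonsingular matrix $P$ such that $P^{-1}\Lambda P=\{P^{-1}AP\mid A\in\Lambda\}$ is a reduced matrix algebra.
   Context: $k$ is an algebraically closed field. For $\underline n=(n_1,\dots,n_t)$ with $n_i\in\{0,1,2,\dots\}$, an $\underline n\times\underline n$ matrix is a matrix $S=[S_{ij}]_{i,j=1}^t$ partitioned into blocks $S_{ij}\in k^{n_i\times n_j}$. An algebra $\Lambda$ of $\underline n\times\underline n$ matrices is a reduced $\underline n\times\underline n$ algebra if there exist an equivalence relation $\sim$ on $T=\{1,\dots,t\}$ and, for each pair $(\mathcal I,\mathcal J)$ of equivalence classes, a finite system of linear equations $\sum_{\mathcal I\ni i<j\in\mathcal J}c^{(l)}_{ij}x_{ij}=0$ ($1\le l\le q_{\mathcal I\mathcal J}$, $c^{(l)}_{ij}\in k$), such that $\Lambda$ consists exactly of all upper block-triangular $\underline n\times\underline n$ matrices $S$ ($S_{ij}=0$ for $i>j$) with $S_{ii}=S_{jj}$ whenever $i\sim j$ and $\sum_{\mathcal I\ni i<j\in\mathcal J}c^{(l)}_{ij}S_{ij}=0$ for all $\mathcal I,\mathcal J,l$. A reduced matrix algebra is a reduced $\underline n\times\underline n$ algebra for some $\underline n$. *)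

theory Defs
  imports "HOL-Computational_Algebra.Polynomial" "Jordan_Normal_Form.Matrix"
begin

definition matrix_algebra :: "nat \<Rightarrow> 'a::field mat set \<Rightarrow> bool" where
  "matrix_algebra n L \<longleftrightarrow>
     L \<subseteq> carrier_mat n n \<and>
     0\<^sub>m n n \<in> L \<and>
     (\<forall>A\<in>L. \<forall>B\<in>L. A + B \<in> L) \<and>
     (\<forall>a. \<forall>A\<in>L. a \<cdot>\<^sub>m A \<in> L) \<and>
     (\<forall>A\<in>L. \<forall>B\<in>L. A * B \<in> L) \<and>
     1\<^sub>m n \<in> L"

text \<open>Block partition given by the list ns = (n_1,...,n_t); blocks indexed 0..t-1.
  blk_start ns i is the offset of the i-th block.\<close>
definition blk_start :: "nat list \<Rightarrow> nat \<Rightarrow> nat" where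
  "blk_start ns i = sum_list (take i ns)"

definition block :: "nat list \<Rightarrow> 'a mat \<Rightarrow> nat \<Rightarrow> nat \<Rightarrow> 'a mat" where
  "block ns S i j = mat (ns ! i) (ns ! j)
      (\<lambda>(r, c). S $$ (blk_start ns i + r, blk_start ns j + c))"

text \<open>L is a reduced ns x ns algebra: there are an equivalence relation R on
  T = {0..<t} (equivalent indices have equal block sizes) and, for each pair of
  equivalence classes (I,J), a finite list of linear equations with coefficients
  c i j (i in I, j in J, i < j), such that L is exactly the set of upper
  block-triangular ns x ns matrices with S_ii = S_jj for i ~ j satisfying all
  equations  sum_{I\<ni>i<j\<in>J} c i j S_ij = 0  (stated entrywise).\<close>
definition reduced_algebra :: "nat list \<Rightarrow> 'a::field mat set \<Rightarrow> bool" where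
  "reduced_algebra ns L \<longleftrightarrow>
    (let t = length ns; n = sum_list ns; T = {0..<t} in
     \<exists>R eqs.
       equiv T R \<and>
       (\<forall>(i, j)\<in>R. ns ! i = ns ! j) \<and>
       L = {S \<in> carrier_mat n n.
              (\<forall>i<t. \<forall>j<t. j < i \<longrightarrow> block ns S i j = 0\<^sub>m (ns ! i) (ns ! j)) \<and>
              (\<forall>(i, j)\<in>R. block ns S i i = block ns S j j) \<and>
              (\<forall>I\<in>T // R. \<forall>J\<in>T // R. \<forall>c\<in>set (eqs I J :: (nat \<Rightarrow> nat \<Rightarrow> 'a) list).
                 \<forall>i0\<in>I. \<forall>j0\<in>J. \<forall>r<ns ! i0. \<forall>s<ns ! j0.
                   (\<Sum>(i, j)\<in>{(i, j). i \<in> I \<and> j \<in> J \<and> i < j}.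
                      c i j * S $$ (blk_start ns i + r, blk_start ns j + s)) = 0)})"

definition reduced_matrix_algebra :: "'a::field mat set \<Rightarrow> bool" where
  "reduced_matrix_algebra L \<longleftrightarrow> (\<exists>ns. reduced_algebra ns L)"

end

theory Submission
  imports Defs "HOL-Library.Function_Algebras"
begin

text \<open>
  Write the identity as a sum of orthogonal primitive idempotents of the algebra. Over an algebraically
  closed field an element of a primitive corner \<open>e L e\<close> is a scalar plus a nilpotent, so isomorphic
  primitive idempotents can be linked by matrix units, and between non-isomorphic ones every element
  is radical. Choose one representative \<open>a\<close> in each isomorphism class. A Nakayama argument yields a basis
  \<open>w\<^sub>0, w\<^sub>1, \<dots>\<close> of the sum of the spaces \<open>a V\<close>, each \<open>w\<^sub>j\<close> lying in one of them, such that radical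
  elements map \<open>w\<^sub>j\<close> into the span of its predecessors. Transporting the \<open>w\<^sub>j\<close> by the matrix units gives a basis
  of \<open>V\<close> in which block \<open>j\<close> consists of the copies of \<open>w\<^sub>j\<close>, blocks of the same class have equal
  diagonal blocks, and the strictly upper blocks between the classes of \<open>a\<close> and \<open>b\<close> are exactly those
  whose entries at each position \<open>(r, s)\<close> form a vector in one fixed subspace, determined by \<open>a L b\<close>;
  this subspace is given by linear equations.
\<close>

section \<open>Polynomials in a linear operator\<close>

text \<open>Entries at different positions \<open>(r, s)\<close> are independent because an element
  of \<open>L\<close> can be cut into pieces: for idempotents \<open>p\<close>, \<open>q\<close>
  isomorphic to \<open>a\<close>, \<open>b\<close>, the maps \<open>x p\<close> and
  \<open>y q\<close> identify \<open>p L q\<close> with \<open>a L b\<close>, and \<open>L\<close>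
  is the direct sum of the \<open>p L q\<close>. Hence an element of \<open>L\<close> amounts to one
  arbitrary element of \<open>a L b\<close> per position, and one system of equations serves all
  positions. Diagonal and strictly upper parts separate because adding a multiple of
  \<open>a\<close> to an element of \<open>a L a\<close> shifts its diagonal coordinates by a common
  amount and leaves the others alone. The obstacle is the order of the blocks: the vectors
  \<open>w\<^sub>j\<close> of all classes must form a single sequence in which every radical map
  goes strictly backwards. So the Nakayama argument treats all representatives at once, in effect
  inside the basic algebra of \<open>L\<close>, and not each space \<open>a V\<close> separately. No
  global Jacobson radical is formed; one-sided invertibility in each corner replaces it.\<close>

locale linear_operators = vector_space scale
  for scale :: "'a::field \<Rightarrow> 'b::ab_group_add \<Rightarrow> 'b" (infixr "*s" 75)
begin

text \<open>The ambient space may have infinite dimension, where \<open>dim\<close> is not monotone;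
  the finite set \<open>B\<close> repairs this. Dimension is the measure both for splitting
  idempotents and for the Nakayama argument.\<close>

lemma dim_psubspace_less:
  assumes "finite B" "T \<subseteq> span B" "subspace S" "S \<subseteq> T" "v \<in> T" "v \<notin> S"
  shows "dim S < dim T"
proof -
  obtain C where C: "C \<subseteq> S" "independent C" "S \<subseteq> span C" "card C = dim S"
    by (rule basis_exists)
  have "v \<notin> span C"
    using C(1) assms(3,6) span_minimal by blast
  then have ind: "independent (insert v C)"
    using C(2) by (rule independent_insertI)
  obtain D where D: "insert v C \<subseteq> D" "D \<subseteq> T" "independent D" "T \<subseteq> span D"
    using maximal_independent_subset_extend[OF _ ind, of T] C(1) assms(4,5) by auto
  have fin: "finite D"
    using independent_span_bound[OF assms(1) D(3)] D(2) assms(2) by auto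
  have "v \<notin> C"
    using \<open>v \<notin> span C\<close> span_base by blast
  then have "card C < card (insert v C)"
    using finite_subset[OF D(1) fin] by simp
  also have "\<dots> \<le> card D"
    using card_mono[OF fin D(1)] .
  finally show ?thesis
    using basis_card_eq_dim[OF D(2,4,3)] C(4) by simp
qed

definition endo :: "('b \<Rightarrow> 'b) \<Rightarrow> bool" where
  "endo f \<longleftrightarrow> (\<forall>u v. f (u + v) = f u + f v) \<and> (\<forall>c v. f (c *s v) = c *s f v)"

lemma endo_add: "endo f \<Longrightarrow> f (u + v) = f u + f v"
  by (auto simp: endo_def)

lemma endo_scale: "endo f \<Longrightarrow> f (c *s v) = c *s f v"
  by (auto simp: endo_def)

lemma endo_zero: "endo f \<Longrightarrow> f 0 = 0"
  using endo_scale[of f 0 0] by simp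

lemma endo_minus: "endo f \<Longrightarrow> f (- v) = - f v"
  using endo_scale[of f "-1" v] by simp

lemma endo_diff: "endo f \<Longrightarrow> f (u - v) = f u - f v"
  using endo_add[of f u "- v"] endo_minus[of f v] by simp

lemma endo_sum: "endo f \<Longrightarrow> f (\<Sum>i\<in>I. g i) = (\<Sum>i\<in>I. f (g i))"
  by (induction I rule: infinite_finite_induct) (auto simp: endo_zero endo_add)

lemma endo_funpow: "endo f \<Longrightarrow> endo (f ^^ k)"
  by (induction k) (auto simp: endo_def)

lemma endo_eq_0_on_span:
  assumes "endo f" "\<And>s. s \<in> S \<Longrightarrow> f s = 0" "v \<in> span S"
  shows "f v = 0"
  using assms(3)
  by (induction rule: span_induct_alt) (auto simp: assms endo_zero endo_add endo_scale)

text \<open>This is \<open>p(f) v\<close> by Horner's scheme, arranged so that the recursion matches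
  \<open>pCons\<close>.\<close>

definition op_poly :: "'a poly \<Rightarrow> ('b \<Rightarrow> 'b) \<Rightarrow> 'b \<Rightarrow> 'b" where
  "op_poly p f v = fold_coeffs (\<lambda>c w. c *s v + f w) p 0"

lemma op_poly_0 [simp]: "op_poly 0 f v = 0"
  by (simp add: op_poly_def)

lemma op_poly_pCons:
  assumes "endo f"
  shows "op_poly (pCons c p) f v = c *s v + f (op_poly p f v)"
  by (cases "c = 0 \<and> p = 0") (auto simp: op_poly_def endo_zero[OF assms])

lemma op_poly_add:
  assumes "endo f"
  shows "op_poly (p + q) f v = op_poly p f v + op_poly q f v"
  by (induction p q rule: poly_induct2)
     (auto simp: op_poly_pCons[OF assms] endo_add[OF assms] scale_left_distrib)

lemma op_poly_smult:
  assumes "endo f"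
  shows "op_poly (Polynomial.smult c p) f v = c *s op_poly p f v"
  by (induction p)
     (auto simp: op_poly_pCons[OF assms] endo_scale[OF assms] scale_right_distrib)

lemma op_poly_mult:
  assumes "endo f"
  shows "op_poly (p * q) f v = op_poly p f (op_poly q f v)"
  by (induction p)
     (auto simp: op_poly_pCons[OF assms] op_poly_add[OF assms] op_poly_smult[OF assms]
        mult_pCons_left)

lemma op_poly_monom:
  assumes "endo f"
  shows "op_poly (monom 1 i) f v = (f ^^ i) v"
  by (induction i)
     (auto simp: op_poly_pCons[OF assms] monom_0 monom_Suc endo_zero[OF assms])

lemma op_poly_commute:
  assumes "endo f"
  shows "op_poly p f (f v) = f (op_poly p f v)"
  by (induction p)
     (auto simp: op_poly_pCons[OF assms] endo_zero[OF assms] endo_add[OF assms] endo_scale[OF assms])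

lemma endo_op_poly:
  assumes "endo f"
  shows "endo (op_poly p f)"
proof (induction p)
  case 0
  then show ?case by (auto simp: endo_def)
next
  case (pCons c p)
  then show ?case
    by (auto simp: endo_def op_poly_pCons[OF assms] endo_add[OF assms] endo_scale[OF assms]
      algebra_simps)
qed

lemma op_poly_in_subspace:
  assumes "endo f" "subspace U" "\<And>u. u \<in> U \<Longrightarrow> f u \<in> U" "v \<in> U"
  shows "op_poly p f v \<in> U"
  by (induction p)
     (auto simp: op_poly_pCons[OF assms(1)] subspace_0[OF assms(2)]
        intro!: subspace_add[OF assms(2)] subspace_scale[OF assms(2)] assms(3,4))

text \<open>The iterates of \<open>v\<close> lie in a finitely generated span, so some
  \<open>(f ^^ k) v\<close> depends on the earlier ones; the dependence is read as a
  polynomial.\<close>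

lemma op_poly_annihilates_vector:
  assumes f: "endo f" and fin: "finite S" and S: "\<And>i. (f ^^ i) v \<in> span S"
  obtains p where "p \<noteq> 0" "op_poly p f v = 0"
proof -
  let ?K = "\<lambda>k. (\<lambda>i. (f ^^ i) v) ` {..<k}"
  have "\<exists>k. (f ^^ k) v \<in> span (?K k)"
  proof (rule ccontr)
    assume asm: "\<not> ?thesis"
    have "independent (?K k) \<and> card (?K k) = k" for k
    proof (induction k)
      case 0
      then show ?case by (simp add: independent_empty)
    next
      case (Suc k)
      have notin: "(f ^^ k) v \<notin> span (?K k)" using asm by blast
      then have "(f ^^ k) v \<notin> ?K k" using span_base[of "(f ^^ k) v" "?K k"] by argo
      moreover have "?K (Suc k) = insert ((f ^^ k) v) (?K k)" by (simp add: lessThan_Suc)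
      moreover have "finite (?K k)" by simp
      ultimately show ?case
        using Suc independent_insertI[OF notin] by (metis card_insert_disjoint)
    qed
    moreover have "?K k \<subseteq> span S" for k
      using S by blast
    ultimately have "Suc (card S) \<le> card S"
      using independent_span_bound[OF fin, of "?K (Suc (card S))"] by metis
    then show False by simp
  qed
  then obtain k where k: "(f ^^ k) v \<in> span (?K k)" ..
  \<comment> \<open>The zero coefficient at \<open>k\<close> guarantees that
    \<open>monom 1 k\<close> is not cancelled later, so the relation is a nonzero
    polynomial.\<close>
  have "\<exists>p. coeff p k = 0 \<and> op_poly p f v = u" if "u \<in> span (?K k)" for u
    using that
  proof (induction rule: span_induct_alt)
    case base
    show ?case by (rule exI[of _ 0]) simp
  next
    case (step c x y)
    then obtain i p where "i < k" "x = (f ^^ i) v" "coeff p k = 0" "op_poly p f v = y"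
      by auto
    then show ?case
      by (intro exI[of _ "Polynomial.smult c (monom 1 i) + p"])
         (auto simp: op_poly_add[OF f] op_poly_smult[OF f] op_poly_monom[OF f])
  qed
  from this[OF k] obtain p where p: "coeff p k = 0" "op_poly p f v = (f ^^ k) v"
    by blast
  let ?q = "monom 1 k + Polynomial.smult (-1) p"
  have "coeff ?q k = 1" using p by simp
  then have "?q \<noteq> 0" by (metis coeff_0 zero_neq_one)
  moreover have "op_poly ?q f v = 0"
    using p by (simp only: op_poly_add[OF f] op_poly_smult[OF f] op_poly_monom[OF f]) simp
  ultimately show ?thesis using that by blast
qed

text \<open>A product of annihilating polynomials of the generators works, since polynomials in
  \<open>f\<close> commute.\<close>

lemma op_poly_annihilates_span:
  assumes f: "endo f" and fin: "finite S" and S: "\<And>v. v \<in> span S \<Longrightarrow> f v \<in> span S"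
  obtains p where "p \<noteq> 0" "\<And>v. v \<in> span S \<Longrightarrow> op_poly p f v = 0"
proof -
  have pow: "(f ^^ i) v \<in> span S" if "v \<in> span S" for i v
    using that by (induction i) (auto intro: S)
  have "\<exists>p. p \<noteq> 0 \<and> (\<forall>s\<in>C. op_poly p f s = 0)" if "finite C" "C \<subseteq> S" for C
    using that
  proof (induction rule: finite_induct)
    case empty
    show ?case by (rule exI[of _ 1]) simp
  next
    case (insert s C)
    then obtain p where p: "p \<noteq> 0" "\<And>s. s \<in> C \<Longrightarrow> op_poly p f s = 0" by auto
    have "s \<in> span S" using insert.prems span_base by blast
    then obtain q where q: "q \<noteq> 0" "op_poly q f s = 0"
      using op_poly_annihilates_vector[OF f fin pow] by blast
    have "op_poly (p * q) f x = 0" if "x \<in> insert s C" for x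
    proof (cases "x = s")
      case True
      then show ?thesis
        using q endo_zero[OF endo_op_poly[OF f]] by (simp add: op_poly_mult[OF f])
    next
      case False
      then have "op_poly (q * p) f x = 0"
        using that p endo_zero[OF endo_op_poly[OF f]] by (simp add: op_poly_mult[OF f])
      then show ?thesis by (simp add: mult.commute)
    qed
    then show ?case using p(1) q(1) by (intro exI[of _ "p * q"]) auto
  qed
  from this[OF fin order.refl] obtain p where "p \<noteq> 0" "\<forall>s\<in>S. op_poly p f s = 0"
    by blast
  then show ?thesis
    using that endo_eq_0_on_span[OF endo_op_poly[OF f]] by blast
qed

text \<open>An annihilating polynomial has the form \<open>X^m (c + X g)\<close> with
  \<open>c\<close> nonzero, so dividing by \<open>-c\<close> expresses \<open>f^m\<close> through
  \<open>f^(m+1)\<close> on the span. The exponent is stated as \<open>Suc m\<close> so that a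
  factor \<open>f\<close> can be split off when a left inverse is built.\<close>

lemma eventually_divisible_power:
  assumes f: "endo f" and fin: "finite S" and S: "\<And>v. v \<in> span S \<Longrightarrow> f v \<in> span S"
  obtains m g where "\<And>v. v \<in> span S \<Longrightarrow> (f ^^ Suc m) v = (f ^^ Suc (Suc m)) (op_poly g f v)"
proof -
  obtain p where p: "p \<noteq> 0" "\<And>v. v \<in> span S \<Longrightarrow> op_poly p f v = 0"
    using op_poly_annihilates_span[OF assms] by blast
  obtain q where q: "p = [:-0, 1:] ^ order 0 p * q" "\<not> [:-0, 1:] dvd q"
    using order_decomp[OF p(1)] by blast
  define m where "m = order 0 p"
  obtain c g where cg: "q = pCons c g" by (cases q)
  have c: "c \<noteq> 0" using q(2) cg by (simp add: dvd_iff_poly_eq_0)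
  have p_eq: "p = monom 1 m * pCons c g"
    using q(1) cg by (simp add: m_def monom_altdef)
  have "(f ^^ m) v = (f ^^ Suc m) (op_poly (Polynomial.smult (- inverse c) g) f v)" if "v \<in> span S" for v
  proof -
    have fsm: "endo (f ^^ Suc m)" by (rule endo_funpow[OF f])
    have fm: "endo (f ^^ m)" by (rule endo_funpow[OF f])
    have "(f ^^ m) (c *s v + f (op_poly g f v)) = 0"
      using p(2)[OF that]
      by (simp only: p_eq op_poly_mult[OF f] op_poly_monom[OF f] op_poly_pCons[OF f])
    then have "c *s (f ^^ m) v = - (f ^^ m) (f (op_poly g f v))"
      by (simp add: endo_add[OF fm] endo_scale[OF fm] eq_neg_iff_add_eq_0)
    then have "inverse c *s c *s (f ^^ m) v = inverse c *s (- (f ^^ m) (f (op_poly g f v)))"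
      by simp
    then have "(f ^^ m) v = - inverse c *s ((f ^^ m) (f (op_poly g f v)))"
      using c by simp
    then show ?thesis
      unfolding op_poly_smult[OF f] endo_scale[OF fsm] by (simp add: funpow_swap1)
  qed
  then have "(f ^^ Suc m) v = (f ^^ Suc (Suc m)) (op_poly (Polynomial.smult (- inverse c) g) f v)"
    if "v \<in> span S" for v
    using that by simp
  then show ?thesis using that by blast
qed

end

text \<open>Linear factors are split off one at a time: the cofactor \<open>q\<close> applied to
  \<open>v\<close> gives either 0, and the degree drops, or an eigenvector. Existence of roots is a
  hypothesis because the scalars here are only a field.\<close>

lemma (in linear_operators) eigenvector_of_op_poly_eq_0:
  assumes f: "endo f" and root: "\<And>p :: 'a poly. degree p > 0 \<Longrightarrow> \<exists>x. poly p x = 0"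
    and "subspace U" "\<And>u. u \<in> U \<Longrightarrow> f u \<in> U"
    and "p \<noteq> 0" "op_poly p f v = 0" "v \<in> U" "v \<noteq> 0"
  shows "\<exists>c w. w \<in> U \<and> w \<noteq> 0 \<and> f w = c *s w"
  using assms(5,6)
proof (induction "degree p" arbitrary: p)
  case 0
  then obtain a where "p = [:a:]" "a \<noteq> 0" using degree_0_id[of p] by (metis pCons_eq_0_iff)
  then show ?case using 0 \<open>v \<noteq> 0\<close> by (simp add: op_poly_pCons[OF f] endo_zero[OF f])
next
  case (Suc d)
  then obtain c where "poly p c = 0" using root[of p] by auto
  then obtain q where q: "p = [:-c, 1:] * q" by (auto simp: poly_eq_0_iff_dvd)
  then have q0: "q \<noteq> 0" using Suc by auto
  let ?w = "op_poly q f v"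
  show ?case
  proof (cases "?w = 0")
    case True
    have "degree p = Suc (degree q)" unfolding q using q0 by (subst degree_mult_eq) auto
    then have "d = degree q" using Suc(2) by simp
    then show ?thesis using Suc.hyps(1) q0 True by blast
  next
    case False
    have "op_poly [:-c, 1:] f ?w = 0" using Suc.prems(2) q by (simp only: op_poly_mult[OF f])
    then have "f ?w = c *s ?w"
      by (simp add: op_poly_pCons[OF f] endo_zero[OF f])
    moreover have "?w \<in> U" using op_poly_in_subspace[OF f] assms by blast
    ultimately show ?thesis using False by blast
  qed
qed

section \<open>Corners and primitive idempotents\<close>

lemma funpow_commute:
  assumes "\<And>v. f (g v) = g (f v)"
  shows "(f ^^ i) ((g ^^ j) v) = (g ^^ j) ((f ^^ i) v)"
proof -
  have "f ((g ^^ j) v) = (g ^^ j) (f v)" for v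
    by (induction j) (auto simp: assms)
  then show ?thesis
    by (induction i) auto
qed

text \<open>\<open>E\<close> is a unit for \<open>L\<close> but not necessarily the identity map.
  The space of interest is \<open>range E\<close>, which is finite-dimensional although the whole
  type need not be.\<close>

locale operator_algebra = linear_operators scale
  for scale :: "'a::alg_closed_field \<Rightarrow> 'b::ab_group_add \<Rightarrow> 'b" (infixr "*s" 75) +
  fixes L :: "('b \<Rightarrow> 'b) set" and E :: "'b \<Rightarrow> 'b"
  assumes L_endo: "f \<in> L \<Longrightarrow> endo f"
    and L_zero: "(\<lambda>v. 0) \<in> L"
    and L_add: "f \<in> L \<Longrightarrow> g \<in> L \<Longrightarrow> (\<lambda>v. f v + g v) \<in> L"
    and L_scale: "f \<in> L \<Longrightarrow> (\<lambda>v. c *s f v) \<in> L"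
    and L_comp: "f \<in> L \<Longrightarrow> g \<in> L \<Longrightarrow> (\<lambda>v. f (g v)) \<in> L"
    and E_in: "E \<in> L"
    and E_left: "f \<in> L \<Longrightarrow> E (f v) = f v"
    and E_right: "f \<in> L \<Longrightarrow> f (E v) = f v"
    and finite_range: "\<exists>S. finite S \<and> range E \<subseteq> span S"
begin

section \<open>Peirce corners and idempotents\<close>

lemma L_diff: "f \<in> L \<Longrightarrow> g \<in> L \<Longrightarrow> (\<lambda>v. f v - g v) \<in> L"
  using L_add[OF _ L_scale[of g "-1"]] by simp

lemma L_sum: "(\<And>i. i \<in> I \<Longrightarrow> f i \<in> L) \<Longrightarrow> (\<lambda>v. \<Sum>i\<in>I. f i v) \<in> L"
  by (induction I rule: infinite_finite_induct) (auto simp: L_zero L_add)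

text \<open>For idempotents \<open>e\<close>, \<open>f\<close> in \<open>L\<close> this is the
  Peirce component \<open>e L f\<close>, given by fixed-point equations instead of as an
  image.\<close>

definition corner :: "('b \<Rightarrow> 'b) \<Rightarrow> ('b \<Rightarrow> 'b) \<Rightarrow> ('b \<Rightarrow> 'b) set" where
  "corner e f = {x \<in> L. \<forall>v. e (x v) = x v \<and> x (f v) = x v}"

lemma cornerD:
  assumes "x \<in> corner e f"
  shows "x \<in> L" "e (x v) = x v" "x (f v) = x v"
  using assms by (auto simp: corner_def)

lemma corner_endo: "x \<in> corner e f \<Longrightarrow> endo x"
  using cornerD(1) L_endo by blast

lemma corner_comp:
  "x \<in> corner e f \<Longrightarrow> y \<in> corner g h \<Longrightarrow> (\<lambda>v. x (y v)) \<in> corner e h"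
  by (auto simp: corner_def L_comp)

lemma corner_scale:
  "e \<in> L \<Longrightarrow> x \<in> corner e f \<Longrightarrow> (\<lambda>v. c *s x v) \<in> corner e f"
  using L_endo[of e] by (auto simp: corner_def L_scale endo_scale)

lemma corner_add:
  "e \<in> L \<Longrightarrow> x \<in> corner e f \<Longrightarrow> y \<in> corner e f \<Longrightarrow> (\<lambda>v. x v + y v) \<in> corner e f"
  using L_endo[of e] by (auto simp: corner_def L_add endo_add)

lemma corner_diff:
  "e \<in> L \<Longrightarrow> x \<in> corner e f \<Longrightarrow> y \<in> corner e f \<Longrightarrow> (\<lambda>v. x v - y v) \<in> corner e f"
  using L_endo[of e] by (auto simp: corner_def L_diff endo_diff)

lemma corner_zero: "e \<in> L \<Longrightarrow> (\<lambda>v. 0) \<in> corner e f"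
  using L_endo[of e] by (auto simp: corner_def L_zero endo_zero)

lemma corner_trans:
  assumes u: "u \<in> corner e e" and f: "f \<in> corner u u"
  shows "f \<in> corner e e"
proof -
  have "e (f v) = f v" for v
    using cornerD(2)[OF u, of "f v"] cornerD(2)[OF f, of v] by simp
  moreover have "f (e v) = f v" for v
    using cornerD(3)[OF f, of "e v"] cornerD(3)[OF u, of v] cornerD(3)[OF f, of v] by simp
  ultimately show ?thesis using cornerD(1)[OF f] by (simp add: corner_def)
qed

definition idem :: "('b \<Rightarrow> 'b) \<Rightarrow> bool" where
  "idem e \<longleftrightarrow> e \<in> L \<and> (\<forall>v. e (e v) = e v)"

lemma idem_in_corner: "idem e \<Longrightarrow> e \<in> corner e e"
  by (auto simp: idem_def corner_def)

definition primitive :: "('b \<Rightarrow> 'b) \<Rightarrow> bool" where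
  "primitive e \<longleftrightarrow> idem e \<and> (\<exists>v. e v \<noteq> 0) \<and>
     (\<forall>u\<in>corner e e. (\<forall>v. u (u v) = u v) \<longrightarrow> u = (\<lambda>v. 0) \<or> u = e)"

lemma primitive_idem: "primitive e \<Longrightarrow> idem e"
  by (simp add: primitive_def)

lemma primitive_in_L: "primitive e \<Longrightarrow> e \<in> L"
  by (simp add: primitive_def idem_def)

lemma subspace_range:
  assumes "f \<in> L"
  shows "subspace (range f)"
proof -
  note f = L_endo[OF assms]
  show ?thesis
  proof (rule subspaceI)
    show "0 \<in> range f" using endo_zero[OF f] by (metis rangeI)
    show "u + v \<in> range f" if "u \<in> range f" "v \<in> range f" for u v
      using that by (auto simp: endo_add[OF f, symmetric])
    show "c *s u \<in> range f" if "u \<in> range f" for c u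
      using that by (auto simp: endo_scale[OF f, symmetric])
  qed
qed

lemma range_eq_span:
  assumes "f \<in> L"
  obtains S where "finite S" "range f = span S"
proof -
  obtain S where S: "finite S" "range E \<subseteq> span S" using finite_range by blast
  have "f v \<in> range E" for v using E_left[OF assms, of v] rangeI[of E "f v"] by simp
  then have "range f \<subseteq> range E" by blast
  obtain B where B: "B \<subseteq> range f" "independent B" "range f \<subseteq> span B"
    by (rule basis_exists)
  have "finite B"
    using independent_span_bound[OF S(1) B(2)] B(1) S(2) \<open>range f \<subseteq> range E\<close> by blast
  moreover have "span B \<subseteq> range f"
    using span_minimal[OF B(1) subspace_range[OF assms]] .
  ultimately show ?thesis using that B(3) by blast
qed

lemma corner_funpow:
  assumes "x \<in> corner e e" "c \<in> corner e f"
  shows "(\<lambda>v. (x ^^ k) (c v)) \<in> corner e f"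
proof (induction k)
  case (Suc k)
  then show ?case using corner_comp[OF assms(1) Suc] by simp
qed (simp add: assms)

text \<open>The constant term of a polynomial would give a multiple of the identity map, which need
  not lie in \<open>L\<close>; precomposing with \<open>e\<close> replaces it by a multiple of
  \<open>e\<close>, the unit of the corner.\<close>

lemma corner_op_poly:
  assumes e: "idem e" and x: "x \<in> corner e e"
  shows "(\<lambda>v. op_poly p x (e v)) \<in> corner e e"
proof (induction p)
  case 0
  then show ?case using e by (simp add: corner_zero idem_def)
next
  case (pCons c p)
  have "(\<lambda>v. c *s e v + x (op_poly p x (e v))) \<in> corner e e"
    using e corner_comp[OF x pCons(2)] corner_scale idem_in_corner[OF e]
    by (auto intro!: corner_add simp: idem_def)
  then show ?case by (simp add: op_poly_pCons[OF corner_endo[OF x]])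
qed

text \<open>A polynomial in \<open>x\<close> is an idempotent projecting onto the stable range of \<open>x\<close> (Fitting);
  primitivity leaves only the two extreme cases.\<close>
lemma primitive_nilpotent_or_left_invertible:
  assumes e: "primitive e" and x: "x \<in> corner e e"
  shows "(\<exists>k. \<forall>v. (x ^^ k) (e v) = 0) \<or> (\<exists>y\<in>corner e e. \<forall>v. y (x v) = e v)"
proof -
  note ei = primitive_idem[OF e]
  note xe = corner_endo[OF x]
  obtain S where S: "finite S" "range e = span S"
    using range_eq_span[OF primitive_in_L[OF e]] by blast
  have "x v \<in> span S" if "v \<in> span S" for v
    using cornerD(2)[OF x, of v] S(2) rangeI[of e "x v"] by simp
  then obtain m g where mg:
    "\<And>v. v \<in> span S \<Longrightarrow> (x ^^ Suc m) v = (x ^^ Suc (Suc m)) (op_poly g x v)"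
    using eventually_divisible_power[OF xe S(1)] by blast
  define M where "M = Suc m"
  define G where "G = op_poly g x"
  have mg': "(x ^^ M) (e v) = (x ^^ Suc M) (G (e v))" for v
    unfolding M_def G_def by (rule mg) (use S(2) in blast)
  have Gc: "(\<lambda>v. G (e v)) \<in> corner e e"
    unfolding G_def by (rule corner_op_poly[OF ei x])
  have Gx: "G (x v) = x (G v)" for v
    unfolding G_def by (rule op_poly_commute[OF xe])
  have Gk: "(\<lambda>v. (G ^^ k) (e v)) \<in> corner e e" for k
  proof (induction k)
    case 0
    then show ?case by (simp add: idem_in_corner[OF ei])
  next
    case (Suc k)
    have "(\<lambda>v. G (e ((G ^^ k) (e v)))) \<in> corner e e"
      using corner_comp[OF Gc Suc] .
    then show ?case by (simp add: cornerD(2)[OF Suc])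
  qed
  have eG: "e ((G ^^ k) (e v)) = (G ^^ k) (e v)" for k v
    using cornerD(2)[OF Gk] .
  \<comment> \<open>Each extra factor \<open>x\<close> is compensated by a factor \<open>G\<close>,
    which undoes \<open>x\<close> on the stable range. Taking \<open>k = M\<close> gives the
    idempotent \<open>u\<close>.\<close>
  have iter: "(x ^^ M) (e v) = (x ^^ (k + M)) ((G ^^ k) (e v))" for k v
  proof (induction k)
    case (Suc k)
    have "(x ^^ (k + M)) ((G ^^ k) (e v)) = (x ^^ k) ((x ^^ M) (e ((G ^^ k) (e v))))"
      by (simp add: funpow_add eG)
    also have "\<dots> = (x ^^ k) ((x ^^ Suc M) (G (e ((G ^^ k) (e v)))))"
      by (simp only: mg')
    also have "\<dots> = (x ^^ (k + Suc M)) ((G ^^ Suc k) (e v))"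
      by (simp add: funpow_add eG funpow_swap1)
    finally show ?case using Suc by simp
  qed simp
  define u where "u = (\<lambda>v. (x ^^ M) ((G ^^ M) (e v)))"
  have uc: "u \<in> corner e e"
    unfolding u_def by (rule corner_funpow[OF x Gk])
  have com: "(G ^^ j) ((x ^^ i) v) = (x ^^ i) ((G ^^ j) v)" for i j v
    by (rule funpow_commute, rule Gx)
  have u_alt: "(x ^^ M) (e v) = (x ^^ M) (u v)" for v
    using iter[of v M] by (simp add: u_def funpow_add)
  have "u (u v) = u v" for v
  proof -
    have "u (u v) = (x ^^ M) ((G ^^ M) (u v))"
      using cornerD(2)[OF uc] unfolding u_def[THEN fun_cong, of "u v"] by simp
    also have "\<dots> = (x ^^ M) ((x ^^ M) ((G ^^ M) ((G ^^ M) (e v))))"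
      by (simp add: u_def com)
    also have "\<dots> = (x ^^ (M + M)) ((G ^^ M) (e ((G ^^ M) (e v))))"
      by (simp add: funpow_add eG)
    also have "\<dots> = u v"
      unfolding iter[symmetric] by (simp add: eG u_def)
    finally show ?thesis .
  qed
  then have "u = (\<lambda>v. 0) \<or> u = e"
    using e uc by (auto simp: primitive_def)
  then show ?thesis
  proof
    assume "u = (\<lambda>v. 0)"
    then have "(x ^^ M) (e v) = 0" for v
      using u_alt endo_zero[OF endo_funpow[OF xe]] by simp
    then show ?thesis by blast
  next
    assume ue: "u = e"
    \<comment> \<open>Since \<open>M = Suc m\<close>, one factor \<open>x\<close> of
      \<open>u\<close> can be moved to the right; what remains is a left inverse of
      \<open>x\<close>.\<close>
    let ?y = "\<lambda>v. (x ^^ m) ((G ^^ M) (e v))"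
    have "?y (x v) = e v" for v
    proof -
      have "?y (x v) = (x ^^ m) ((G ^^ M) ((x ^^ 1) (e v)))"
        using cornerD(2,3)[OF x] by simp
      also have "\<dots> = u v"
        by (simp only: com) (simp add: u_def M_def funpow_swap1 del: funpow.simps(2), simp add: funpow_swap1)
      finally show ?thesis using ue by simp
    qed
    moreover have "?y \<in> corner e e" by (rule corner_funpow[OF x Gk])
    ultimately show ?thesis by (intro disjI2 bexI[of _ ?y]) simp_all
  qed
qed

text \<open>The maps in \<open>corner b a\<close> without a left inverse: for primitive \<open>a\<close>, \<open>b\<close> this is the part of the
  Jacobson radical in that corner.\<close>
definition rad :: "('b \<Rightarrow> 'b) \<Rightarrow> ('b \<Rightarrow> 'b) \<Rightarrow> ('b \<Rightarrow> 'b) set" where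
  "rad b a = {z \<in> corner b a. \<not> (\<exists>y\<in>corner a b. \<forall>v. y (z v) = a v)}"

lemma rad_corner: "z \<in> rad b a \<Longrightarrow> z \<in> corner b a"
  by (simp add: rad_def)

text \<open>For primitive \<open>a\<close> the product \<open>y z\<close> is nilpotent or has a left
  inverse \<open>w\<close>; in the second case \<open>w y\<close> would be a left inverse of
  \<open>z\<close>.\<close>

lemma rad_nilpotent:
  assumes a: "primitive a" and z: "z \<in> rad b a" and y: "y \<in> corner a b"
  shows "\<exists>k. \<forall>v. ((\<lambda>v. y (z v)) ^^ k) (a v) = 0"
proof (rule ccontr)
  assume "\<not> ?thesis"
  then obtain w where w: "w \<in> corner a a" "\<And>v. w (y (z v)) = a v"
    using primitive_nilpotent_or_left_invertible[OF a corner_comp[OF y rad_corner[OF z]]] by blast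
  have "(\<lambda>v. w (y v)) \<in> corner a b" by (rule corner_comp[OF w(1) y])
  then show False using z w(2) by (auto simp: rad_def)
qed

text \<open>Algebraic closedness enters here: \<open>x\<close> has an eigenvector in
  \<open>range e\<close>, and subtracting the eigenvalue times \<open>e\<close> leaves a map that
  kills it, hence one without left inverse in the corner.\<close>

lemma corner_eq_scalar_plus_rad:
  assumes e: "primitive e" and x: "x \<in> corner e e"
  shows "\<exists>c. (\<lambda>v. x v - c *s e v) \<in> rad e e"
proof -
  note ei = primitive_idem[OF e]
  note eL = primitive_in_L[OF e]
  have ee: "e (e v) = e v" for v using ei by (simp add: idem_def)
  note xe = corner_endo[OF x]
  obtain S where S: "finite S" "range e = span S"
    using range_eq_span[OF eL] by blast
  obtain v where v: "e v \<noteq> 0" using e by (auto simp: primitive_def)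
  have stab: "x u \<in> range e" if "u \<in> range e" for u
    using cornerD(2)[OF x, of u] rangeI[of e "x u"] by simp
  have "(x ^^ i) (e v) \<in> span S" for i
    unfolding S(2)[symmetric] by (induction i) (auto intro: stab)
  then obtain p where p: "p \<noteq> 0" "op_poly p x (e v) = 0"
    using op_poly_annihilates_vector[OF xe S(1)] by blast
  obtain c w where w: "w \<in> range e" "w \<noteq> 0" "x w = c *s w"
    using eigenvector_of_op_poly_eq_0[OF xe alg_closed_imp_poly_has_root subspace_range[OF eL] stab p _ v]
    by blast
  have ew: "e w = w" using w(1) ee by auto
  let ?z = "\<lambda>v. x v - c *s e v"
  have zc: "?z \<in> corner e e"
    by (intro corner_diff corner_scale eL x idem_in_corner[OF ei])
  have False if "y \<in> corner e e" "\<And>v. y (?z v) = e v" for y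
    using that(2)[of w] ew w endo_zero[OF corner_endo[OF that(1)]] by simp
  then show ?thesis using zc by (auto simp: rad_def intro!: exI[of _ c])
qed

section \<open>Isomorphism of idempotents\<close>

definition iso :: "('b \<Rightarrow> 'b) \<Rightarrow> ('b \<Rightarrow> 'b) \<Rightarrow> bool" where
  "iso e f \<longleftrightarrow> (\<exists>x\<in>corner e f. \<exists>y\<in>corner f e. (\<forall>v. x (y v) = e v) \<and> (\<forall>v. y (x v) = f v))"

lemma iso_refl: "idem e \<Longrightarrow> iso e e"
  unfolding iso_def using idem_in_corner unfolding idem_def by blast

lemma iso_sym: "iso e f \<Longrightarrow> iso f e"
  unfolding iso_def by blast

lemma iso_trans:
  assumes "iso e f" "iso f g"
  shows "iso e g"
proof -
  obtain x y where xy: "x \<in> corner e f" "y \<in> corner f e" "\<And>v. x (y v) = e v" "\<And>v. y (x v) = f v"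
    using assms(1) by (auto simp: iso_def)
  obtain x' y' where xy': "x' \<in> corner f g" "y' \<in> corner g f" "\<And>v. x' (y' v) = f v" "\<And>v. y' (x' v) = g v"
    using assms(2) by (auto simp: iso_def)
  have "(\<lambda>v. x (x' v)) \<in> corner e g" "(\<lambda>v. y' (y v)) \<in> corner g e"
    using xy xy' corner_comp by blast+
  then show ?thesis
    unfolding iso_def
    by (intro bexI[of _ "\<lambda>v. x (x' v)"] bexI[of _ "\<lambda>v. y' (y v)"])
       (simp_all add: xy xy' cornerD[OF xy(1)] cornerD[OF xy'(2)])
qed

text \<open>If \<open>y\<close> were a left inverse of \<open>z\<close>, then \<open>z y\<close>
  would be an idempotent in the corner of \<open>b\<close>. Primitivity makes it \<open>b\<close>,
  which gives an isomorphism, or 0, which forces \<open>a = 0\<close>.\<close>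

lemma corner_subset_rad:
  assumes a: "primitive a" and b: "primitive b" and "\<not> iso a b" and z: "z \<in> corner b a"
  shows "z \<in> rad b a"
proof -
  have False if y: "y \<in> corner a b" "\<And>v. y (z v) = a v" for y
  proof -
    let ?u = "\<lambda>v. z (y v)"
    have u: "?u \<in> corner b b" by (rule corner_comp[OF z y(1)])
    moreover have "\<forall>v. ?u (?u v) = ?u v" using cornerD[OF y(1)] y(2) by simp
    ultimately have "?u = (\<lambda>v. 0) \<or> ?u = b" using b by (auto simp: primitive_def)
    then show False
    proof
      assume "?u = (\<lambda>v. 0)"
      then have "z (y w) = 0" for w by metis
      then have "a (a w) = 0" for w
        using y(2)[of "a w"] cornerD(2)[OF y(1), of "z (a w)"] y(2)[of "a (a w)"]
          cornerD(3)[OF z] y(2)[of w] endo_zero[OF corner_endo[OF y(1)]] by metis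
      then show False using a by (auto simp: primitive_def idem_def)
    next
      assume "?u = b"
      then have "z (y w) = b w" for w by metis
      then have "iso a b" using y z by (auto simp: iso_def)
      then show False using assms(3) by simp
    qed
  qed
  then show ?thesis using z by (auto simp: rad_def)
qed

section \<open>Decomposition into primitive idempotents and matrix units\<close>

definition primitive_decomposition :: "('b \<Rightarrow> 'b) set \<Rightarrow> ('b \<Rightarrow> 'b) \<Rightarrow> bool" where
  "primitive_decomposition F e \<longleftrightarrow> finite F \<and> (\<forall>f\<in>F. primitive f) \<and> F \<subseteq> corner e e \<and>
    (\<forall>f\<in>F. \<forall>g\<in>F. f \<noteq> g \<longrightarrow> (\<forall>v. f (g v) = 0)) \<and> (\<forall>v. e v = (\<Sum>f\<in>F. f v))"

lemma primitive_decompositionD: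
  assumes "primitive_decomposition F e"
  shows "finite F" "\<And>f. f \<in> F \<Longrightarrow> primitive f" "\<And>f. f \<in> F \<Longrightarrow> f \<in> corner e e"
    "\<And>f g v. f \<in> F \<Longrightarrow> g \<in> F \<Longrightarrow> f \<noteq> g \<Longrightarrow> f (g v) = 0" "\<And>v. e v = (\<Sum>f\<in>F. f v)"
  using assms unfolding primitive_decomposition_def by blast+

text \<open>A nontrivial idempotent \<open>u\<close> of the corner splits \<open>e\<close> into
  \<open>u\<close> and \<open>e - u\<close>, both with range a proper subspace of
  \<open>range e\<close>; hence the induction on the dimension of the range.\<close>

lemma primitive_decomposition_exists:
  assumes "idem e"
  shows "\<exists>F. primitive_decomposition F e"
  using assms
proof (induction "dim (range e)" arbitrary: e rule: less_induct)
  case less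
  note ei = less.prems
  consider "e = (\<lambda>v. 0)" | "primitive e" |
    u where "u \<in> corner e e" "\<And>v. u (u v) = u v" "u \<noteq> (\<lambda>v. 0)" "u \<noteq> e"
    using ei unfolding primitive_def by blast
  then show ?case
  proof cases
    \<comment> \<open>The zero idempotent is the empty sum; \<open>E\<close> itself is zero for
      matrices of size 0.\<close>
    case 1
    then show ?thesis by (intro exI[of _ "{}"]) (auto simp: primitive_decomposition_def)
  next
    case 2
    then show ?thesis
      using idem_in_corner[OF ei] by (intro exI[of _ "{e}"]) (auto simp: primitive_decomposition_def)
  next
    case 3
    have eL: "e \<in> L" using ei by (simp add: idem_def)
    have ee: "e (e v) = e v" for v using ei by (simp add: idem_def)
    note u = cornerD[OF 3(1)] 3(2)
    note ue = L_endo[OF u(1)]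
    define u' where "u' = (\<lambda>v. e v - u v)"
    have u'c: "u' \<in> corner e e"
      unfolding u'_def by (rule corner_diff[OF eL idem_in_corner[OF ei] 3(1)])
    note u' = cornerD[OF u'c]
    have uu': "u (u' v) = 0" for v by (simp add: u'_def endo_diff[OF ue] u)
    have u'u: "u' (u v) = 0" for v by (simp add: u'_def u)
    have u'u': "u' (u' v) = u' v" for v
      using u'(3)[of v] u'u[of v] endo_diff[OF L_endo[OF u'(1)], of "e v" "u v"]
      by (simp add: u'_def)
    obtain S where S: "finite S" "range e = span S" using range_eq_span[OF eL] by blast
    have sub: "range u \<subseteq> range e" "range u' \<subseteq> range e"
      using u(2) u'(2) rangeI[of e] by (metis image_subsetI)+
    obtain v where v: "u v \<noteq> 0" using 3(3) by blast
    obtain v' where v': "u' v' \<noteq> 0" using 3(4) unfolding u'_def by (metis eq_iff_diff_eq_0 ext)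
    \<comment> \<open>\<open>u\<close> and \<open>u'\<close> annihilate each other, so a nonzero
      vector of one range cannot lie in the other. This gives both strict inclusions.\<close>
    have "u' v' \<notin> range u" using v' uu' u(4) by (metis rangeE)
    then have d1: "dim (range u) < dim (range e)"
      using dim_psubspace_less[OF S(1) _ subspace_range[OF u(1)] sub(1), of "u' v'"] S(2) sub(2) by blast
    have "u v \<notin> range u'" using v u'u u'u' by (metis rangeE)
    then have d2: "dim (range u') < dim (range e)"
      using dim_psubspace_less[OF S(1) _ subspace_range[OF u'(1)] sub(2), of "u v"] S(2) sub(1) by blast
    have "idem u" "idem u'" using u u' u'u' by (simp_all add: idem_def)
    then obtain F G where FG_dec: "primitive_decomposition F u" "primitive_decomposition G u'"
      using less.hyps d1 d2 by blast
    note F = primitive_decompositionD[OF FG_dec(1)]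
    note G = primitive_decompositionD[OF FG_dec(2)]
    have FG: "f (g v) = 0" if "f \<in> F" "g \<in> G" for f g v
      using cornerD(3)[OF F(3)[OF that(1)], of "g v"] cornerD(2)[OF G(3)[OF that(2)], of v]
        uu'[of "g v"] endo_zero[OF corner_endo[OF F(3)[OF that(1)]]] by simp
    have GF: "g (f v) = 0" if "f \<in> F" "g \<in> G" for f g v
      using cornerD(3)[OF G(3)[OF that(2)], of "f v"] cornerD(2)[OF F(3)[OF that(1)], of v]
        u'u[of "f v"] endo_zero[OF corner_endo[OF G(3)[OF that(2)]]] by simp
    have disj: "F \<inter> G = {}"
    proof (rule ccontr)
      assume "F \<inter> G \<noteq> {}"
      then obtain f where f: "f \<in> F" "f \<in> G" by blast
      then show False using FG[OF f] F(2)[OF f(1)] by (auto simp: primitive_def idem_def)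
    qed
    have "e v = (\<Sum>f\<in>F \<union> G. f v)" for v
      using sum.union_disjoint[OF F(1) G(1) disj, of "\<lambda>f. f v"]
      unfolding F(5)[of v, symmetric] G(5)[of v, symmetric] by (simp add: u'_def)
    moreover have "F \<union> G \<subseteq> corner e e"
      using F(3) G(3) corner_trans 3(1) u'c by blast
    moreover have "f (g v) = 0" if "f \<in> F \<union> G" "g \<in> F \<union> G" "f \<noteq> g" for f g v
      using that F(4)[of f g v] G(4)[of f g v] FG[of f g v] GF[of g f v] by blast
    ultimately have "primitive_decomposition (F \<union> G) e"
      using F(1,2) G(1,2) unfolding primitive_decomposition_def by blast
    then show ?thesis ..
  qed
qed

text \<open>The usual matrix units are the composites of \<open>y f\<close> after \<open>x g\<close>
  for \<open>\<rho> f = \<rho> g\<close>; only the maps to and from the representative are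
  stored.\<close>

definition matrix_units ::
  "('b \<Rightarrow> 'b) set \<Rightarrow> (('b \<Rightarrow> 'b) \<Rightarrow> ('b \<Rightarrow> 'b)) \<Rightarrow> (('b \<Rightarrow> 'b) \<Rightarrow> ('b \<Rightarrow> 'b)) \<Rightarrow>
    (('b \<Rightarrow> 'b) \<Rightarrow> ('b \<Rightarrow> 'b)) \<Rightarrow> bool" where
  "matrix_units F \<rho> x y \<longleftrightarrow> primitive_decomposition F E \<and>
    (\<forall>f\<in>F. \<rho> f \<in> F \<and> \<rho> (\<rho> f) = \<rho> f \<and> x f \<in> corner (\<rho> f) f \<and> y f \<in> corner f (\<rho> f) \<and>
      (\<forall>v. x f (y f v) = \<rho> f v) \<and> (\<forall>v. y f (x f v) = f v)) \<and>
    (\<forall>a\<in>\<rho> ` F. \<forall>b\<in>\<rho> ` F. a \<noteq> b \<longrightarrow> \<not> iso a b)"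

lemma matrix_units_exist: "\<exists>F \<rho> x y. matrix_units F \<rho> x y"
proof -
  have "idem E" by (simp add: idem_def E_in E_left[OF E_in])
  then obtain F where dec: "primitive_decomposition F E"
    using primitive_decomposition_exists by blast
  note F = primitive_decompositionD[OF dec]
  \<comment> \<open>The choice depends on \<open>f\<close> only through the predicate
    \<open>iso f\<close>, so isomorphic idempotents get the same representative.\<close>
  define \<rho> where "\<rho> f = (SOME g. g \<in> F \<and> iso f g)" for f
  have "\<rho> f \<in> F \<and> iso f (\<rho> f)" if "f \<in> F" for f
    unfolding \<rho>_def by (rule someI[of _ f]) (use that F(2) primitive_idem iso_refl in blast)
  then have \<rho>: "\<rho> f \<in> F" "iso f (\<rho> f)" if "f \<in> F" for f using that by blast+
  have \<rho>_eq: "\<rho> f = \<rho> g" if "iso f g" for f g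
  proof -
    have "iso f h \<longleftrightarrow> iso g h" for h using that iso_sym iso_trans by blast
    then show ?thesis by (simp add: \<rho>_def)
  qed
  have \<rho>\<rho>: "\<rho> (\<rho> f) = \<rho> f" if "f \<in> F" for f using \<rho>_eq[OF \<rho>(2)[OF that]] by simp
  have "\<exists>x y. x \<in> corner (\<rho> f) f \<and> y \<in> corner f (\<rho> f) \<and> (\<forall>v. x (y v) = \<rho> f v) \<and> (\<forall>v. y (x v) = f v)"
    if "f \<in> F" for f
    using \<rho>(2)[OF that] unfolding iso_def by blast
  then obtain x y where xy: "\<And>f. f \<in> F \<Longrightarrow> x f \<in> corner (\<rho> f) f \<and> y f \<in> corner f (\<rho> f) \<and>
      (\<forall>v. x f (y f v) = \<rho> f v) \<and> (\<forall>v. y f (x f v) = f v)"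
    by metis
  have noniso: "\<not> iso a b" if "a \<in> \<rho> ` F" "b \<in> \<rho> ` F" "a \<noteq> b" for a b
    using that \<rho>_eq[of a b] \<rho>\<rho> by auto
  have "matrix_units F \<rho> x y"
    unfolding matrix_units_def using dec \<rho>(1) \<rho>\<rho> xy noniso by blast
  then show ?thesis by blast
qed

end

section \<open>Triangular bases\<close>

text \<open>With one idempotent per class, the corners between members of \<open>A\<close> form the
  basic algebra: modulo radical maps there are only scalars inside each \<open>corner a a\<close>
  and nothing between distinct members.\<close>

locale nonisomorphic_idempotents = operator_algebra scale L E
  for scale :: "'a::alg_closed_field \<Rightarrow> 'b::ab_group_add \<Rightarrow> 'b" (infixr "*s" 75)
    and L :: "('b \<Rightarrow> 'b) set" and E :: "'b \<Rightarrow> 'b" +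
  fixes A :: "('b \<Rightarrow> 'b) set"
  assumes A_primitive: "a \<in> A \<Longrightarrow> primitive a"
    and A_orthogonal: "a \<in> A \<Longrightarrow> b \<in> A \<Longrightarrow> a \<noteq> b \<Longrightarrow> a (b v) = 0"
    and A_not_iso: "a \<in> A \<Longrightarrow> b \<in> A \<Longrightarrow> a \<noteq> b \<Longrightarrow> \<not> iso a b"
begin

lemma A_L: "a \<in> A \<Longrightarrow> a \<in> L"
  using A_primitive primitive_in_L by blast

lemma A_endo: "a \<in> A \<Longrightarrow> endo a"
  using A_L L_endo by blast

lemma A_corner: "a \<in> A \<Longrightarrow> a \<in> corner a a"
  using A_primitive primitive_idem idem_in_corner by blast

lemma A_idem: "a \<in> A \<Longrightarrow> a (a v) = a v"
  using cornerD(2)[OF A_corner] by blast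

lemma corner_off_diagonal: "a \<in> A \<Longrightarrow> b \<in> A \<Longrightarrow> a \<noteq> b \<Longrightarrow> z \<in> corner b a \<Longrightarrow> z \<in> rad b a"
  using corner_subset_rad A_primitive A_not_iso by blast

lemma corner_diagonal: "a \<in> A \<Longrightarrow> x \<in> corner a a \<Longrightarrow> \<exists>c. (\<lambda>v. x v - c *s a v) \<in> rad a a"
  using corner_eq_scalar_plus_rad A_primitive by blast

text \<open>The label \<open>a\<close> records the space \<open>a V\<close> that contains
  \<open>w\<close>. The prefixes span a flag of submodules over the basic algebra, with
  one-dimensional steps.\<close>

inductive triangular :: "('b \<times> ('b \<Rightarrow> 'b)) list \<Rightarrow> bool" where
  triangular_Nil: "triangular []"
| triangular_snoc: "triangular ps \<Longrightarrow> a \<in> A \<Longrightarrow> a w = w \<Longrightarrow> w \<notin> span (fst ` set ps) \<Longrightarrow>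
    (\<And>b z. b \<in> A \<Longrightarrow> z \<in> rad b a \<Longrightarrow> z w \<in> span (fst ` set ps)) \<Longrightarrow> triangular (ps @ [(w, a)])"

lemma triangular_basis:
  "triangular ps \<Longrightarrow> independent (fst ` set ps) \<and> distinct (map fst ps)"
proof (induction rule: triangular.induct)
  case triangular_Nil
  then show ?case by (simp add: independent_empty)
next
  case (triangular_snoc ps a w)
  have "w \<notin> fst ` set ps" using triangular_snoc(4) span_base by blast
  then show ?case using triangular_snoc(6) independent_insertI[OF triangular_snoc(4)] by auto
qed

lemma triangular_nth:
  assumes "triangular ps" "j < length ps"
  shows "snd (ps ! j) \<in> A \<and> snd (ps ! j) (fst (ps ! j)) = fst (ps ! j) \<and>
    (\<forall>b\<in>A. \<forall>z\<in>rad b (snd (ps ! j)). z (fst (ps ! j)) \<in> span (fst ` set (take j ps)))"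
  using assms
proof (induction rule: triangular.induct)
  case (triangular_snoc ps a w)
  show ?case
  proof (cases "j < length ps")
    case True
    then show ?thesis using triangular_snoc.IH by (simp add: nth_append)
  next
    case False
    then have "j = length ps" using triangular_snoc.prems by simp
    then show ?thesis using triangular_snoc.hyps by simp
  qed
qed simp

text \<open>It is enough to look at a generator \<open>w\<close> with label \<open>a\<close>. A map
  out of \<open>c\<close> different from \<open>a\<close> kills it by orthogonality; a map out of
  \<open>a\<close> is radical or, when it returns to \<open>a\<close>, a scalar plus a radical
  map.\<close>

lemma triangular_stable:
  assumes ps: "triangular ps" and "b \<in> A" "c \<in> A" and x: "x \<in> corner b c" and u: "u \<in> span (fst ` set ps)"
  shows "x u \<in> span (fst ` set ps)"
proof -
  note xe = corner_endo[OF x]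
  have gen: "x w \<in> span (fst ` set ps)" if w_in: "w \<in> fst ` set ps" for w
  proof -
    obtain q where q: "q \<in> set ps" "w = fst q"
      using w_in by (rule imageE)
    obtain j where j: "j < length ps" "ps ! j = q"
      using q(1) by (auto simp: in_set_conv_nth)
    define a where "a = snd (ps ! j)"
    have a: "a \<in> A" "a w = w" "\<And>b z. b \<in> A \<Longrightarrow> z \<in> rad b a \<Longrightarrow> z w \<in> span (fst ` set ps)"
      using triangular_nth[OF ps j(1)] span_mono[OF image_mono[OF set_take_subset], of fst j ps]
      unfolding a_def j(2) q(2) by blast+
    show ?thesis
    proof (cases "c = a")
      case False
      have "c w = 0" using A_orthogonal[OF \<open>c \<in> A\<close> a(1) False, of w] a(2) by simp
      then have "x w = 0" using cornerD(3)[OF x, of w] endo_zero[OF xe] by simp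
      then show ?thesis by (simp add: span_zero)
    next
      case True
      show ?thesis
      proof (cases "b = a")
        case False
        then show ?thesis
          using a(3)[OF \<open>b \<in> A\<close>] corner_off_diagonal[OF a(1) \<open>b \<in> A\<close>] x True by blast
      next
        case ba: True
        obtain k where "(\<lambda>v. x v - k *s a v) \<in> rad a a"
          using corner_diagonal[OF a(1)] x True ba by blast
        then have "x w - k *s a w \<in> span (fst ` set ps)" using a(3)[OF a(1)] by blast
        moreover have "k *s a w \<in> span (fst ` set ps)"
          using span_scale[OF span_base[OF w_in]] a(2) by simp
        ultimately show ?thesis using span_add[of "x w - k *s a w" _ "k *s a w"] by simp
      qed
    qed
  qed
  from u show ?thesis
    by (induction rule: span_induct_alt)
       (simp_all add: endo_zero[OF xe] endo_add[OF xe] endo_scale[OF xe] gen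
         span_zero span_add span_scale)
qed

lemma triangular_range:
  assumes "triangular ps"
  shows "fst ` set ps \<subseteq> range E"
proof
  fix w assume "w \<in> fst ` set ps"
  then obtain j where j: "j < length ps" "w = fst (ps ! j)"
    unfolding in_set_conv_nth image_iff Bex_def by blast
  then have "snd (ps ! j) \<in> A" "snd (ps ! j) w = w"
    using triangular_nth[OF assms j(1)] by auto
  then have "E w = w" using E_left[OF A_L, of "snd (ps ! j)" w] by simp
  then show "w \<in> range E" using rangeI[of E w] by simp
qed

text \<open>\<open>L\<close> is closed under linear combinations, so the orbit of \<open>w\<close>
  is already a subspace.\<close>

lemma span_orbit:
  assumes "s \<in> span ((\<lambda>x. x w) ` L)"
  shows "\<exists>y\<in>L. s = y w"
  using assms
proof (induction rule: span_induct_alt)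
  case base
  then show ?case using L_zero by (intro bexI[of _ "\<lambda>v. 0"]) auto
next
  case (step c s t)
  then obtain x y where "x \<in> L" "s = x w" "y \<in> L" "t = y w" by blast
  then show ?case using L_add[OF L_scale[of x c], of y] by (intro bexI[of _ "\<lambda>v. c *s x v + y v"]) auto
qed

text \<open>A form of Nakayama's lemma: \<open>w\<close> cannot lie in the submodule generated by \<open>z w\<close> modulo \<open>U\<close>.\<close>
lemma triangular_extend:
  assumes ps: "triangular ps" and v: "a \<in> A" "a v \<notin> span (fst ` set ps)"
  shows "\<exists>w c. triangular (ps @ [(w, c)])"
proof -
  define U where "U = span (fst ` set ps)"
  have U: "subspace U" by (simp add: U_def subspace_span)
  define C where "C = {(w, c). c \<in> A \<and> c w = w \<and> w \<notin> U}"
  \<comment> \<open>\<open>M w\<close> adds to \<open>U\<close> the orbit of \<open>w\<close> under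
    \<open>L\<close>. The next basis vector is a candidate for which this space has least
    dimension.\<close>
  define M where "M w = span (U \<union> (\<lambda>x. x w) ` L)" for w
  have "(a v, a) \<in> C" using v A_idem by (simp add: C_def U_def)
  then obtain p where p: "p \<in> C" "\<And>q. q \<in> C \<Longrightarrow> dim (M (fst p)) \<le> dim (M (fst q))"
    using exists_least_iff[of "\<lambda>n. \<exists>p\<in>C. dim (M (fst p)) = n"] by (metis linorder_not_less)
  obtain w c where pwc: "p = (w, c)" by (cases p)
  have w: "c \<in> A" "c w = w" "w \<notin> U" using p(1) pwc by (auto simp: C_def)
  have Ew: "E w = w" using E_left[OF A_L[OF w(1)], of w] w(2) by simp
  obtain S where S: "finite S" "range E \<subseteq> span S" using finite_range by blast
  have MS: "M w \<subseteq> span S"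
  proof -
    have "U \<subseteq> span S"
      unfolding U_def using triangular_range[OF ps] S(2) by (intro span_minimal) auto
    moreover have "x w \<in> span S" if "x \<in> L" for x
      using S(2) E_left[OF that, of w] rangeI[of E "x w"] by auto
    ultimately show ?thesis unfolding M_def by (intro span_minimal) auto
  qed
  have "z w \<in> U" if b: "b \<in> A" and z: "z \<in> rad b c" for b z
  proof (rule ccontr)
    assume zw: "z w \<notin> U"
    note zc = rad_corner[OF z]
    have "(z w, b) \<in> C" using zw b cornerD(2)[OF zc] by (simp add: C_def)
    \<comment> \<open>\<open>z w\<close> is again a candidate and \<open>M (z w)\<close> lies in
      \<open>M w\<close>, so minimality forces equality; hence \<open>w\<close> itself is in
      \<open>M (z w)\<close>.\<close>
    then have le: "dim (M w) \<le> dim (M (z w))" using p(2) pwc by force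
    have "x (z w) \<in> M w" if "x \<in> L" for x
      unfolding M_def using L_comp[OF that cornerD(1)[OF zc]]
      by (intro span_base UnI2) (auto intro!: image_eqI[of _ _ "\<lambda>v. x (z v)"])
    then have sub: "M (z w) \<subseteq> M w"
      unfolding M_def[of "z w"] by (intro span_minimal) (auto simp: M_def intro: span_base)
    have "w \<in> (\<lambda>x. x w) ` L" using Ew E_in by (intro image_eqI[of _ _ E]) simp_all
    then have "w \<in> M w" unfolding M_def by (intro span_base UnI2)
    then have "w \<in> M (z w)"
      using dim_psubspace_less[OF S(1) MS _ sub, of w] le by (auto simp: M_def subspace_span)
    then obtain u s where us: "w = u + s" "u \<in> span U" "s \<in> span ((\<lambda>x. x (z w)) ` L)"
      unfolding M_def span_Un by blast
    then obtain y where y: "y \<in> L" "s = y (z w)" using span_orbit by blast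
    have u: "u \<in> U" using us(2) by (simp add: U_def span_span)
    \<comment> \<open>The coefficient \<open>y\<close> is an arbitrary element of \<open>L\<close>;
      cutting it down to \<open>corner c b\<close> makes \<open>q = y' z\<close> nilpotent by
      \<open>rad_nilpotent\<close> and keeps \<open>U\<close> stable.\<close>
    define y' where "y' = (\<lambda>v. c (y (b v)))"
    have y': "y' \<in> corner c b"
      unfolding corner_def y'_def 
      using A_idem[OF w(1)] A_idem[OF b] L_comp[OF A_L[OF w(1)] L_comp[OF y(1) A_L[OF b]]] by simp
    define q where "q = (\<lambda>v. y' (z v))"
    have qc: "q \<in> corner c c" unfolding q_def by (rule corner_comp[OF y' zc])
    note qe = corner_endo[OF qc]
    have cu: "c u \<in> U"
      using triangular_stable[OF ps w(1) w(1) A_corner[OF w(1)]] u by (simp add: U_def)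
    have "q w = c s" by (simp add: q_def y'_def y(2) cornerD(2)[OF zc])
    then have "w - q w = c u"
      using us(1) w(2) endo_add[OF A_endo[OF w(1)], of u s] by (metis add_diff_cancel_right')
    then have wq: "w - q w \<in> U" using cu by simp
    \<comment> \<open>Modulo \<open>U\<close> the map \<open>q\<close> fixes \<open>w\<close>, and
      so does every power; a vanishing power puts \<open>w\<close> in \<open>U\<close>.\<close>
    have "w - (q ^^ k) w \<in> U" for k
    proof (induction k)
      case 0
      then show ?case by (simp add: subspace_0[OF U])
    next
      case (Suc k)
      have "q (w - (q ^^ k) w) \<in> U"
        using triangular_stable[OF ps w(1) w(1) qc] Suc by (simp add: U_def)
      then have "(w - q w) + q (w - (q ^^ k) w) \<in> U"
        using subspace_add[OF U wq] by blast
      then show ?case by (simp add: endo_diff[OF qe])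
    qed
    moreover obtain k where "(q ^^ k) (c w) = 0"
      using rad_nilpotent[OF A_primitive[OF w(1)] z y'] unfolding q_def by blast
    ultimately have "w - 0 \<in> U" using w(2) by metis
    then show False using w(3) by simp
  qed
  then have "triangular (ps @ [(w, c)])"
    using triangular_snoc[OF ps w(1,2)] w(3) by (simp add: U_def)
  then show ?thesis by blast
qed

text \<open>Triangular lists are independent families in \<open>range E\<close>, so their lengths
  are bounded; a list of greatest length cannot be extended and therefore spans.\<close>

lemma triangular_complete:
  "\<exists>ps. triangular ps \<and> (\<forall>a\<in>A. \<forall>v. a v \<in> span (fst ` set ps))"
proof -
  obtain S where S: "finite S" "range E \<subseteq> span S" using finite_range by blast
  have "length ps \<le> card S" if "triangular ps" for ps
  proof -
    have "fst ` set ps \<subseteq> span S" using triangular_range[OF that] S(2) by blast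
    then have "card (fst ` set ps) \<le> card S"
      using independent_span_bound[OF S(1)] triangular_basis[OF that] by blast
    then show ?thesis
      using distinct_card[of "map fst ps"] triangular_basis[OF that] by simp
  qed
  then have "\<forall>qs. triangular qs \<longrightarrow> length qs < Suc (card S)"
    by (simp add: less_Suc_eq_le)
  from ex_has_greatest_nat[OF triangular_Nil this]
  obtain ps where ps: "triangular ps" "\<And>qs. triangular qs \<Longrightarrow> length qs \<le> length ps"
    by blast
  have "a v \<in> span (fst ` set ps)" if a: "a \<in> A" for a v
  proof (rule ccontr)
    assume "\<not> ?thesis"
    then obtain w c where "triangular (ps @ [(w, c)])" using triangular_extend[OF ps(1) a] by blast
    then show False using ps(2)[of "ps @ [(w, c)]"] by simp
  qed
  then show ?thesis using ps(1) by blast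
qed

text \<open>Later arguments use the triangular basis only through this dual system. The bound
  \<open>j \<le> i\<close> in the last clause includes \<open>i = j\<close>: radical maps have zero
  diagonal.\<close>

definition triangular_coordinates ::
  "nat \<Rightarrow> (nat \<Rightarrow> 'b) \<Rightarrow> (nat \<Rightarrow> 'b \<Rightarrow> 'b) \<Rightarrow> (nat \<Rightarrow> 'b \<Rightarrow> 'a) \<Rightarrow> bool" where
  "triangular_coordinates t w \<alpha> c \<longleftrightarrow>
    (\<forall>j<t. \<alpha> j \<in> A \<and> \<alpha> j (w j) = w j) \<and>
    (\<forall>i<t. \<forall>u v. c i (u + v) = c i u + c i v) \<and>
    (\<forall>i<t. \<forall>k v. c i (k *s v) = k * c i v) \<and>
    (\<forall>i<t. \<forall>j<t. c i (w j) = (if i = j then 1 else 0)) \<and>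
    (\<forall>a\<in>A. \<forall>v. a v = (\<Sum>i | i < t \<and> \<alpha> i = a. c i v *s w i)) \<and>
    (\<forall>j<t. \<forall>b\<in>A. \<forall>z\<in>rad b (\<alpha> j). \<forall>i<t. j \<le> i \<longrightarrow> c i (z (w j)) = 0)"

lemma triangular_coordinates_exist: "\<exists>t w \<alpha> c. triangular_coordinates t w \<alpha> c"
proof -
  obtain ps where ps: "triangular ps" "\<And>a v. a \<in> A \<Longrightarrow> a v \<in> span (fst ` set ps)"
    using triangular_complete by blast
  define t where "t = length ps"
  define w where "w j = fst (ps ! j)" for j
  define \<alpha> where "\<alpha> j = snd (ps ! j)" for j
  define B where "B = fst ` set ps"
  \<comment> \<open>\<open>representation\<close> is linear only on \<open>span B\<close>.
    Projecting with \<open>\<alpha> i\<close> first gives a functional that is linear on the whole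
    type and ignores components with other labels.\<close>
  define c where "c i v = representation B (\<alpha> i v) (w i)" for i v
  have B: "independent B" "finite B" using triangular_basis[OF ps(1)] by (simp_all add: B_def)
  have nth: "\<alpha> j \<in> A" "\<alpha> j (w j) = w j"
    "\<And>b z. b \<in> A \<Longrightarrow> z \<in> rad b (\<alpha> j) \<Longrightarrow> z (w j) \<in> span (fst ` set (take j ps))" if "j < t" for j
    using triangular_nth[OF ps(1)] that by (auto simp: t_def \<alpha>_def w_def)
  have aB: "a v \<in> span B" if "a \<in> A" for a v using ps(2)[OF that] by (simp add: B_def)
  have inj: "w i = w j \<longleftrightarrow> i = j" if "i < t" "j < t" for i j
    using triangular_basis[OF ps(1)] that nth_eq_iff_index_eq[of "map fst ps" i j]
    by (simp add: t_def w_def)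
  have wB: "w j \<in> B" if "j < t" for j using that by (simp add: t_def w_def B_def)
  have B_eq: "B = w ` {..<t}"
    by (force simp: B_def w_def t_def in_set_conv_nth image_iff)
  have "c i (u + v) = c i u + c i v" if "i < t" for i u v
    using representation_add[OF B(1) aB aB] nth(1)[OF that] endo_add[OF A_endo[OF nth(1)[OF that]]]
    by (simp add: c_def)
  moreover have "c i (k *s v) = k * c i v" if "i < t" for i k v
    using representation_scale[OF B(1) aB] nth(1)[OF that] endo_scale[OF A_endo[OF nth(1)[OF that]]]
    by (simp add: c_def)
  moreover have "c i (w j) = (if i = j then 1 else 0)" if "i < t" "j < t" for i j
  proof (cases "\<alpha> i = \<alpha> j")
    case True
    then have "c i (w j) = representation B (w j) (w i)" using nth(2)[OF that(2)] by (simp add: c_def)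
    then show ?thesis using representation_basis[OF B(1) wB[OF that(2)]] inj[OF that] by simp
  next
    case False
    then have "\<alpha> i (w j) = 0"
      using A_orthogonal[OF nth(1)[OF that(1)] nth(1)[OF that(2)] False, of "w j"] nth(2)[OF that(2)] by simp
    then show ?thesis using False by (auto simp: c_def representation_zero)
  qed
  moreover have "a v = (\<Sum>i | i < t \<and> \<alpha> i = a. c i v *s w i)" if a: "a \<in> A" for a v
  proof -
    note ae = A_endo[OF a]
    have aw: "a (w i) = (if \<alpha> i = a then w i else 0)" if "i < t" for i
      using A_orthogonal[OF a nth(1)[OF that], of "w i"] nth(2)[OF that] by auto
    have "a v = (\<Sum>b\<in>B. representation B (a v) b *s b)"
      using sum_representation_eq[OF B(1) aB[OF a] B(2) order.refl] by simp
    also have "\<dots> = (\<Sum>i<t. representation B (a v) (w i) *s w i)"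
      unfolding B_eq by (subst sum.reindex) (auto simp: inj inj_on_def)
    finally have "a v = (\<Sum>i<t. representation B (a v) (w i) *s w i)" .
    \<comment> \<open>Applying \<open>a\<close> once more removes the basis vectors whose label is
      not \<open>a\<close>.\<close>
    then have "a (a v) = (\<Sum>i<t. representation B (a v) (w i) *s a (w i))"
      by (metis (no_types, lifting) endo_scale[OF ae] endo_sum[OF ae] sum.cong)
    also have "\<dots> = (\<Sum>i<t. if \<alpha> i = a then c i v *s w i else 0)"
      by (intro sum.cong) (auto simp: aw c_def)
    also have "\<dots> = (\<Sum>i | i < t \<and> \<alpha> i = a. c i v *s w i)"
      by (simp add: sum.inter_filter[symmetric])
    finally show ?thesis using A_idem[OF a] by simp
  qed
  moreover have "c i (z (w j)) = 0" if "j < t" "b \<in> A" "z \<in> rad b (\<alpha> j)" "i < t" "j \<le> i" for i j b z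
  proof (cases "\<alpha> i = b")
    case True
    let ?T = "fst ` set (take j ps)"
    have T: "?T \<subseteq> B" by (auto simp: B_def dest: in_set_takeD)
    have "c i (z (w j)) = representation B (z (w j)) (w i)"
      using cornerD(2)[OF rad_corner[OF that(3)]] True by (simp add: c_def)
    \<comment> \<open>\<open>z (w j)\<close> is a combination of the vectors before position
      \<open>j\<close>, so its coefficient at \<open>w i\<close> can be computed in that prefix,
      where \<open>w i\<close> does not occur.\<close>
    also have "\<dots> = representation ?T (z (w j)) (w i)"
      using representation_extend[OF B(1) nth(3)[OF that(1-3)] T] by simp
    also have "\<dots> = 0"
    proof (rule ccontr)
      assume "representation ?T (z (w j)) (w i) \<noteq> 0"
      then have "w i \<in> ?T" using representation_ne_zero by blast
      then obtain l where "l < j" "l < t" "w i = w l"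
        by (auto simp: in_set_conv_nth w_def t_def)
      then show False using inj[OF that(4)] that(5) by auto
    qed
    finally show ?thesis .
  next
    case False
    have "\<alpha> i (z (w j)) = 0"
      using A_orthogonal[OF nth(1)[OF that(4)] that(2) False, of "z (w j)"]
        cornerD(2)[OF rad_corner[OF that(3)], of "w j"] by simp
    then show ?thesis by (simp add: c_def representation_zero)
  qed
  ultimately have "triangular_coordinates t w \<alpha> c"
    using nth(1,2) unfolding triangular_coordinates_def by blast
  then show ?thesis by blast
qed

end

section \<open>The reduced form in a basis of matrix units\<close>

text \<open>This is Gaussian elimination on the index set \<open>X\<close>. Only the restriction of
  \<open>W\<close> to \<open>X\<close> matters, hence the condition that some member of
  \<open>W\<close> agrees with \<open>f\<close> on \<open>X\<close>.\<close>

lemma subspace_eq_solutions: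
  fixes W :: "('i \<Rightarrow> 'a::field) set"
  assumes "finite X" and "(\<lambda>i. 0) \<in> W" and "\<And>f g. f \<in> W \<Longrightarrow> g \<in> W \<Longrightarrow> (\<lambda>i. f i + g i) \<in> W"
    and "\<And>k f. f \<in> W \<Longrightarrow> (\<lambda>i. k * f i) \<in> W"
  shows "\<exists>cs. \<forall>f. (\<exists>g\<in>W. \<forall>i\<in>X. g i = f i) \<longleftrightarrow> (\<forall>c\<in>set cs. (\<Sum>i\<in>X. c i * f i) = 0)"
  using assms
proof (induction X arbitrary: W rule: finite_induct)
  case empty
  then show ?case by (intro exI[of _ "[]"]) auto
next
  case (insert x X)
  define W' where "W' = {g \<in> W. g x = 0}"
  have "\<exists>cs. \<forall>f. (\<exists>g\<in>W'. \<forall>i\<in>X. g i = f i) \<longleftrightarrow> (\<forall>c\<in>set cs. (\<Sum>i\<in>X. c i * f i) = 0)"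
    by (rule insert.IH) (auto simp: W'_def insert.prems)
  then obtain cs where cs: "\<And>f. (\<exists>g\<in>W'. \<forall>i\<in>X. g i = f i) \<longleftrightarrow> (\<forall>c\<in>set cs. (\<Sum>i\<in>X. c i * f i) = 0)"
    by blast
  have upd: "(\<Sum>i\<in>insert x X. (c(x := k)) i * f i) = k * f x + (\<Sum>i\<in>X. c i * f i)" for c k and f :: "'i \<Rightarrow> 'a"
    using insert.hyps by (auto intro!: sum.cong)
  show ?case
  proof (cases "\<exists>h\<in>W. h x \<noteq> 0")
    case False
    \<comment> \<open>All members of \<open>W\<close> vanish at \<open>x\<close>: one equation says
      so, and the others are extended by 0 there.\<close>
    let ?cs = "((\<lambda>i. 0)(x := 1)) # map (\<lambda>c. c(x := 0)) cs"
    have "(\<exists>g\<in>W. \<forall>i\<in>insert x X. g i = f i) \<longleftrightarrow> (\<forall>c\<in>set ?cs. (\<Sum>i\<in>insert x X. c i * f i) = 0)" for f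
    proof -
      have "(\<exists>g\<in>W. \<forall>i\<in>insert x X. g i = f i) \<longleftrightarrow> f x = 0 \<and> (\<exists>g\<in>W'. \<forall>i\<in>X. g i = f i)"
      proof
        assume "\<exists>g\<in>W. \<forall>i\<in>insert x X. g i = f i"
        then obtain g where g: "g \<in> W" "\<forall>i\<in>insert x X. g i = f i" by blast
        then have gx: "g x = 0" using False by blast
        then have "g \<in> W'" using g(1) by (simp add: W'_def)
        moreover have "f x = 0" using g(2) gx by (metis insertI1)
        ultimately show "f x = 0 \<and> (\<exists>g\<in>W'. \<forall>i\<in>X. g i = f i)" using g(2) by blast
      next
        assume "f x = 0 \<and> (\<exists>g\<in>W'. \<forall>i\<in>X. g i = f i)"
        then obtain g where "f x = 0" "g \<in> W" "g x = 0" "\<forall>i\<in>X. g i = f i" by (auto simp: W'_def)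
        then show "\<exists>g\<in>W. \<forall>i\<in>insert x X. g i = f i" by (intro bexI[of _ g]) simp_all
      qed
      also have "\<dots> \<longleftrightarrow> (\<forall>c\<in>set ?cs. (\<Sum>i\<in>insert x X. c i * f i) = 0)"
        unfolding cs by (simp only: set_simps set_map ball_simps upd) simp
      finally show ?thesis .
    qed
    then show ?thesis by blast
  next
    case True
    then obtain h0 where h0: "h0 \<in> W" "h0 x \<noteq> 0" by blast
    define h where "h = (\<lambda>i. inverse (h0 x) * h0 i)"
    have h: "h \<in> W" "h x = 1" using h0 insert.prems(3) by (auto simp: h_def)
    \<comment> \<open>\<open>h\<close> serves as pivot. The new coefficient at \<open>x\<close>
      makes the extended equation for \<open>f\<close> say the same as the old one for
      \<open>f - f x * h\<close>.\<close>
    let ?cs = "map (\<lambda>c. c(x := - (\<Sum>i\<in>X. c i * h i))) cs"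
    have "(\<exists>g\<in>W. \<forall>i\<in>insert x X. g i = f i) \<longleftrightarrow> (\<forall>c\<in>set ?cs. (\<Sum>i\<in>insert x X. c i * f i) = 0)" for f
    proof -
      have "(\<exists>g\<in>W. \<forall>i\<in>insert x X. g i = f i) \<longleftrightarrow> (\<exists>g\<in>W'. \<forall>i\<in>X. g i = f i - f x * h i)"
      proof
        assume "\<exists>g\<in>W. \<forall>i\<in>insert x X. g i = f i"
        then obtain g where g: "g \<in> W" "\<forall>i\<in>insert x X. g i = f i" by blast
        have "(\<lambda>i. g i + (- f x) * h i) \<in> W" using insert.prems(2)[OF g(1) insert.prems(3)[OF h(1)]] .
        then have "(\<lambda>i. g i + (- f x) * h i) \<in> W'" using g(2) h(2) by (simp add: W'_def)
        then show "\<exists>g\<in>W'. \<forall>i\<in>X. g i = f i - f x * h i" 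
          using g(2) by (intro bexI[of _ "\<lambda>i. g i + (- f x) * h i"]) simp_all
      next
        assume "\<exists>g\<in>W'. \<forall>i\<in>X. g i = f i - f x * h i"
        then obtain g where g: "g \<in> W" "g x = 0" "\<forall>i\<in>X. g i = f i - f x * h i" by (auto simp: W'_def)
        have "(\<lambda>i. g i + f x * h i) \<in> W" using insert.prems(2)[OF g(1) insert.prems(3)[OF h(1)]] .
        moreover have "\<forall>i\<in>insert x X. g i + f x * h i = f i" using g h(2) by simp
        ultimately show "\<exists>g\<in>W. \<forall>i\<in>insert x X. g i = f i"
          by (intro bexI[of _ "\<lambda>i. g i + f x * h i"])
      qed
      also have "\<dots> \<longleftrightarrow> (\<forall>c\<in>set cs. (\<Sum>i\<in>X. c i * (f i - f x * h i)) = 0)" by (rule cs)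
      also have "\<dots> \<longleftrightarrow> (\<forall>c\<in>set ?cs. (\<Sum>i\<in>insert x X. c i * f i) = 0)"
      proof -
        have "(\<Sum>i\<in>X. c i * (f i - f x * h i)) = - (\<Sum>i\<in>X. c i * h i) * f x + (\<Sum>i\<in>X. c i * f i)" for c
          by (simp add: algebra_simps sum_subtractf sum_distrib_left)
        then show ?thesis by (simp only: set_map ball_simps upd)
      qed
      finally show ?thesis .
    qed
    then show ?thesis by blast
  qed
qed

locale matrix_unit_basis = nonisomorphic_idempotents scale L E A
  for scale :: "'a::alg_closed_field \<Rightarrow> 'b::ab_group_add \<Rightarrow> 'b" (infixr "*s" 75)
    and L :: "('b \<Rightarrow> 'b) set" and E :: "'b \<Rightarrow> 'b" and A :: "('b \<Rightarrow> 'b) set" +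
  fixes F :: "('b \<Rightarrow> 'b) set" and \<rho> x y :: "('b \<Rightarrow> 'b) \<Rightarrow> ('b \<Rightarrow> 'b)"
    and t :: nat and w :: "nat \<Rightarrow> 'b" and \<alpha> :: "nat \<Rightarrow> ('b \<Rightarrow> 'b)" and c :: "nat \<Rightarrow> 'b \<Rightarrow> 'a"
  assumes units: "matrix_units F \<rho> x y" and A_eq: "A = \<rho> ` F"
    and coordinates: "triangular_coordinates t w \<alpha> c"
begin

lemma dec: "primitive_decomposition F E"
  using units unfolding matrix_units_def by blast

lemma finite_F: "finite F"
  using primitive_decompositionD(1)[OF dec] .

lemma \<rho>_in_A: "f \<in> F \<Longrightarrow> \<rho> f \<in> A"
  by (simp add: A_eq)

lemma x_corner: "f \<in> F \<Longrightarrow> x f \<in> corner (\<rho> f) f"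
  and y_corner: "f \<in> F \<Longrightarrow> y f \<in> corner f (\<rho> f)"
  and x_y: "f \<in> F \<Longrightarrow> x f (y f v) = \<rho> f v"
  and y_x: "f \<in> F \<Longrightarrow> y f (x f v) = f v"
  using units unfolding matrix_units_def by blast+

lemma x_endo: "f \<in> F \<Longrightarrow> endo (x f)"
  and y_endo: "f \<in> F \<Longrightarrow> endo (y f)"
  using corner_endo x_corner y_corner by blast+

lemma x_y_orthogonal:
  assumes "f \<in> F" "g \<in> F" "f \<noteq> g"
  shows "x f (y g v) = 0"
  using cornerD(3)[OF x_corner[OF assms(1)], of "y g v"] cornerD(2)[OF y_corner[OF assms(2)], of v]
    primitive_decompositionD(4)[OF dec assms, of "y g v"] endo_zero[OF x_endo[OF assms(1)]] by simp

lemma \<alpha>_in_A: "j < t \<Longrightarrow> \<alpha> j \<in> A"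
  and \<alpha>_w: "j < t \<Longrightarrow> \<alpha> j (w j) = w j"
  using coordinates[unfolded triangular_coordinates_def, THEN conjunct1] by blast+

lemma c_add: "i < t \<Longrightarrow> c i (u + v) = c i u + c i v"
  using coordinates[unfolded triangular_coordinates_def, THEN conjunct2, THEN conjunct1] by blast

lemma c_scale: "i < t \<Longrightarrow> c i (k *s v) = k * c i v"
  using coordinates[unfolded triangular_coordinates_def, THEN conjunct2, THEN conjunct2, THEN conjunct1] by blast

lemma c_w: "i < t \<Longrightarrow> j < t \<Longrightarrow> c i (w j) = (if i = j then 1 else 0)"
  using coordinates[unfolded triangular_coordinates_def, THEN conjunct2, THEN conjunct2, THEN conjunct2, THEN conjunct1] by blast

lemma A_expand: "a \<in> A \<Longrightarrow> a v = (\<Sum>i | i < t \<and> \<alpha> i = a. c i v *s w i)"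
  using coordinates[unfolded triangular_coordinates_def, THEN conjunct2, THEN conjunct2, THEN conjunct2, THEN conjunct2, THEN conjunct1] by blast

lemma c_rad: "j < t \<Longrightarrow> b \<in> A \<Longrightarrow> z \<in> rad b (\<alpha> j) \<Longrightarrow> i < t \<Longrightarrow> j \<le> i \<Longrightarrow> c i (z (w j)) = 0"
  using coordinates[unfolded triangular_coordinates_def, THEN conjunct2, THEN conjunct2, THEN conjunct2, THEN conjunct2, THEN conjunct2] by blast

lemma c_zero: "i < t \<Longrightarrow> c i 0 = 0"
  using c_scale[of i 0 0] by simp

text \<open>Modulo the radical \<open>z\<close> is a multiple \<open>l\<close> of \<open>a\<close>
  or zero, and radical maps contribute only strictly above the diagonal. That one \<open>l\<close>
  serves all \<open>i\<close> is the source of the equal diagonal blocks.\<close>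

lemma corner_coordinates:
  assumes a: "a \<in> A" and b: "b \<in> A" and z: "z \<in> corner a b"
  shows "\<exists>l. \<forall>i<t. \<forall>j<t. \<alpha> i = a \<longrightarrow> \<alpha> j = b \<longrightarrow> j \<le> i \<longrightarrow> c i (z (w j)) = (if i = j then l else 0)"
proof (cases "a = b")
  case True
  then obtain l where l: "(\<lambda>v. z v - l *s a v) \<in> rad a a"
    using corner_diagonal[OF a] z by blast
  have "c i (z (w j)) = (if i = j then l else 0)"
    if "i < t" "j < t" "\<alpha> i = a" "\<alpha> j = b" "j \<le> i" for i j
  proof -
    have "c i (z (w j) - l *s a (w j)) = 0"
      using c_rad[OF that(2) a _ that(1,5), of "\<lambda>v. z v - l *s a v"] l that(4) True by simp
    moreover have "a (w j) = w j" using \<alpha>_w[OF that(2)] that True by simp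
    ultimately have "c i (z (w j)) = c i (l *s w j)"
      using c_add[OF that(1), of "z (w j) - l *s w j" "l *s w j"] by simp
    then show ?thesis using c_scale[OF that(1)] c_w[OF that(1,2)] by simp
  qed
  then show ?thesis by blast
next
  case False
  then have "z \<in> rad a b" using corner_off_diagonal[OF b a] z by blast
  then have "c i (z (w j)) = 0" if "i < t" "j < t" "\<alpha> i = a" "\<alpha> j = b" "j \<le> i" for i j
    using c_rad[OF that(2) a _ that(1,5), of z] that(4) by simp
  then show ?thesis by (intro exI[of _ 0]) simp
qed

section \<open>The transported basis and its coordinates\<close>

definition cls :: "('b \<Rightarrow> 'b) \<Rightarrow> ('b \<Rightarrow> 'b) set" where
  "cls a = {f \<in> F. \<rho> f = a}"

text \<open>Block \<open>i\<close> of the final partition has size \<open>mult (\<alpha> i)\<close>: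
  one row for each idempotent of \<open>F\<close> represented by \<open>\<alpha> i\<close>.\<close>

definition mult :: "('b \<Rightarrow> 'b) \<Rightarrow> nat" where
  "mult a = card (cls a)"

definition enum :: "('b \<Rightarrow> 'b) \<Rightarrow> nat \<Rightarrow> ('b \<Rightarrow> 'b)" where
  "enum a = (SOME g. bij_betw g {0..<mult a} (cls a))"

lemma bij_enum: "bij_betw (enum a) {0..<mult a} (cls a)"
proof -
  have "finite (cls a)" by (simp add: cls_def finite_F)
  then show ?thesis unfolding enum_def mult_def by (rule someI_ex[OF ex_bij_betw_nat_finite])
qed

lemma enum_in:
  assumes "r < mult a"
  shows "enum a r \<in> F" "\<rho> (enum a r) = a"
  using bij_betwE[OF bij_enum, of a] assms by (auto simp: cls_def)

lemma enum_eq_iff: "r < mult a \<Longrightarrow> s < mult a \<Longrightarrow> enum a r = enum a s \<longleftrightarrow> r = s"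
  using bij_betw_imp_inj_on[OF bij_enum, of a] by (auto simp: inj_on_def)

definition idx :: "('b \<Rightarrow> 'b) \<Rightarrow> nat" where
  "idx f = (SOME r. r < mult (\<rho> f) \<and> enum (\<rho> f) r = f)"

lemma idx_enum:
  assumes "r < mult a"
  shows "idx (enum a r) = r"
proof -
  have "idx (enum a r) < mult a \<and> enum a (idx (enum a r)) = enum a r"
    unfolding idx_def enum_in(2)[OF assms] by (rule someI[of _ r]) (simp add: assms)
  then show ?thesis using enum_eq_iff assms by blast
qed

lemma idx_less:
  assumes "f \<in> F"
  shows "idx f < mult (\<rho> f)"
proof -
  have "f \<in> enum (\<rho> f) ` {0..<mult (\<rho> f)}"
    using bij_betw_imp_surj_on[OF bij_enum, of "\<rho> f"] assms by (simp add: cls_def)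
  then obtain r where "r < mult (\<rho> f)" "f = enum (\<rho> f) r" by auto
  then show ?thesis using idx_enum by metis
qed

definition bas :: "nat \<Rightarrow> nat \<Rightarrow> 'b" where
  "bas i r = y (enum (\<alpha> i) r) (w i)"

definition coord :: "nat \<Rightarrow> nat \<Rightarrow> 'b \<Rightarrow> 'a" where
  "coord i r v = c i (x (enum (\<alpha> i) r) v)"

lemma coord_add:
  assumes "i < t" "r < mult (\<alpha> i)"
  shows "coord i r (u + v) = coord i r u + coord i r v"
  by (simp add: coord_def endo_add[OF x_endo[OF enum_in(1)[OF assms(2)]]] c_add[OF assms(1)])

lemma coord_scale:
  assumes "i < t" "r < mult (\<alpha> i)"
  shows "coord i r (k *s v) = k * coord i r v"
  by (simp add: coord_def endo_scale[OF x_endo[OF enum_in(1)[OF assms(2)]]] c_scale[OF assms(1)])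

lemma coord_bas:
  assumes i: "i < t" "r < mult (\<alpha> i)" and j: "j < t" "s < mult (\<alpha> j)"
  shows "coord i r (bas j s) = (if i = j \<and> r = s then 1 else 0)"
proof (cases "enum (\<alpha> i) r = enum (\<alpha> j) s")
  case True
  then have \<alpha>: "\<alpha> i = \<alpha> j" using enum_in(2)[OF i(2)] enum_in(2)[OF j(2)] by simp
  then have "r = s" using True i(2) j(2) enum_eq_iff by simp
  moreover have "coord i r (bas j s) = c i (w j)"
    unfolding coord_def bas_def True x_y[OF enum_in(1)[OF j(2)]] enum_in(2)[OF j(2)]
    using \<alpha>_w[OF j(1)] by simp
  ultimately show ?thesis using c_w[OF i(1) j(1)] by simp
next
  case False
  then have "coord i r (bas j s) = 0"
    unfolding coord_def bas_def
    using x_y_orthogonal[OF enum_in(1)[OF i(2)] enum_in(1)[OF j(2)] False] c_zero[OF i(1)] by simp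
  moreover have "\<not> (i = j \<and> r = s)" using False by blast
  ultimately show ?thesis by simp
qed

text \<open>Split \<open>E v\<close> into the components \<open>f v\<close>, move each by
  \<open>x f\<close> to the representative, expand there in the \<open>w i\<close>, and move back by
  \<open>y f\<close>. With \<open>coord_bas\<close> this makes the \<open>bas i r\<close> a basis of
  \<open>range E\<close>.\<close>

lemma E_expand: "E v = (\<Sum>i<t. \<Sum>r<mult (\<alpha> i). coord i r v *s bas i r)"
proof -
  let ?g = "\<lambda>f i. c i (x f v) *s y f (w i)"
  have "E v = (\<Sum>f\<in>F. f v)" by (rule primitive_decompositionD(5)[OF dec])
  also have "\<dots> = (\<Sum>f\<in>F. \<Sum>i | i < t \<and> \<alpha> i = \<rho> f. ?g f i)"
  proof (rule sum.cong[OF refl])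
    fix f assume f: "f \<in> F"
    have "f v = y f (\<rho> f (x f v))" using y_x[OF f, of v] cornerD(2)[OF x_corner[OF f], of v] by simp
    also have "\<dots> = (\<Sum>i | i < t \<and> \<alpha> i = \<rho> f. ?g f i)"
      unfolding A_expand[OF \<rho>_in_A[OF f], of "x f v"]
      by (simp add: endo_sum[OF y_endo[OF f]] endo_scale[OF y_endo[OF f]])
    finally show "f v = (\<Sum>i | i < t \<and> \<alpha> i = \<rho> f. ?g f i)" .
  qed
  also have "\<dots> = (\<Sum>f\<in>F. \<Sum>i<t. if \<alpha> i = \<rho> f then ?g f i else 0)"
  proof (rule sum.cong[OF refl])
    fix f
    have "{i. i < t \<and> \<alpha> i = \<rho> f} = {i \<in> {..<t}. \<alpha> i = \<rho> f}" by auto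
    then show "(\<Sum>i | i < t \<and> \<alpha> i = \<rho> f. ?g f i) = (\<Sum>i<t. if \<alpha> i = \<rho> f then ?g f i else 0)"
      by (simp only: sum.inter_filter[OF finite_lessThan])
  qed
  also have "\<dots> = (\<Sum>i<t. \<Sum>f\<in>F. if \<alpha> i = \<rho> f then ?g f i else 0)"
    by (rule sum.swap)
  also have "\<dots> = (\<Sum>i<t. \<Sum>f\<in>cls (\<alpha> i). ?g f i)"
  proof (rule sum.cong[OF refl])
    fix i
    have "cls (\<alpha> i) = {f \<in> F. \<alpha> i = \<rho> f}" by (auto simp: cls_def)
    then show "(\<Sum>f\<in>F. if \<alpha> i = \<rho> f then ?g f i else 0) = (\<Sum>f\<in>cls (\<alpha> i). ?g f i)"
      by (simp only: sum.inter_filter[OF finite_F])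
  qed
  also have "\<dots> = (\<Sum>i<t. \<Sum>r<mult (\<alpha> i). coord i r v *s bas i r)"
    by (intro sum.cong[OF refl])
       (simp add: coord_def bas_def sum.reindex_bij_betw[OF bij_enum, symmetric] atLeast0LessThan)
  finally show ?thesis .
qed

section \<open>Equations for the strictly upper coordinates\<close>

definition pairs :: "('b \<Rightarrow> 'b) \<Rightarrow> ('b \<Rightarrow> 'b) \<Rightarrow> (nat \<times> nat) set" where
  "pairs a b = {(i, j). i < t \<and> j < t \<and> \<alpha> i = a \<and> \<alpha> j = b \<and> i < j}"

lemma finite_pairs: "finite (pairs a b)"
  by (rule finite_subset[of _ "{..<t} \<times> {..<t}"]) (auto simp: pairs_def)

lemma corner_equations:
  assumes a: "a \<in> A" and b: "b \<in> A"
  shows "\<exists>cs. \<forall>f. (\<exists>z\<in>corner a b. \<forall>(i, j)\<in>pairs a b. c i (z (w j)) = f (i, j)) \<longleftrightarrow>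
    (\<forall>k\<in>set cs. (\<Sum>p\<in>pairs a b. k p * f p) = 0)"
proof -
  \<comment> \<open>The value is set to 0 off \<open>pairs a b\<close> because \<open>c i\<close> is
    known to be linear only for \<open>i < t\<close>.\<close>
  let ?m = "\<lambda>z p. if p \<in> pairs a b then c (fst p) (z (w (snd p))) else 0"
  let ?W = "?m ` corner a b"
  have "\<exists>cs. \<forall>f. (\<exists>g\<in>?W. \<forall>i\<in>pairs a b. g i = f i) \<longleftrightarrow>
    (\<forall>k\<in>set cs. (\<Sum>p\<in>pairs a b. k p * f p) = 0)"
  proof (rule subspace_eq_solutions[OF finite_pairs])
    show "(\<lambda>i. 0) \<in> ?W"
      using corner_zero[OF A_L[OF a], of b]
      by (intro image_eqI[of _ _ "\<lambda>v. 0"]) (auto simp: fun_eq_iff c_zero pairs_def)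
    show "(\<lambda>i. f i + g i) \<in> ?W" if "f \<in> ?W" "g \<in> ?W" for f g
    proof -
      obtain z z' where z: "z \<in> corner a b" "f = ?m z" "z' \<in> corner a b" "g = ?m z'"
        using \<open>f \<in> ?W\<close> \<open>g \<in> ?W\<close> by blast
      show ?thesis
        using corner_add[OF A_L[OF a] z(1,3)] unfolding z(2,4)
        by (intro image_eqI[of _ _ "\<lambda>v. z v + z' v"]) (auto simp: fun_eq_iff c_add pairs_def)
    qed
    show "(\<lambda>i. k * f i) \<in> ?W" if "f \<in> ?W" for k f
    proof -
      obtain z where z: "z \<in> corner a b" "f = ?m z"
        using \<open>f \<in> ?W\<close> by blast
      show ?thesis
        using corner_scale[OF A_L[OF a] z(1)] unfolding z(2)
        by (intro image_eqI[of _ _ "\<lambda>v. k *s z v"]) (auto simp: fun_eq_iff c_scale pairs_def)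
    qed
  qed
  then show ?thesis
    by (simp add: case_prod_beta)
qed

text \<open>Adding a multiple of \<open>a\<close> to an element of \<open>corner a a\<close> changes
  only its diagonal coordinates, all by the same amount. So the equations have to control only the
  strictly upper part.\<close>

lemma corner_interpolation:
  assumes a: "a \<in> A" and b: "b \<in> A"
    and lower: "\<And>i j. i < t \<Longrightarrow> j < i \<Longrightarrow> \<alpha> i = a \<Longrightarrow> \<alpha> j = b \<Longrightarrow> f i j = 0"
    and diag: "\<And>i j. a = b \<Longrightarrow> i < t \<Longrightarrow> j < t \<Longrightarrow> \<alpha> i = a \<Longrightarrow> \<alpha> j = a \<Longrightarrow> f i i = f j j"
    and upper: "\<exists>z\<in>corner a b. \<forall>(i, j)\<in>pairs a b. c i (z (w j)) = f i j"
  shows "\<exists>z\<in>corner a b. \<forall>i<t. \<forall>j<t. \<alpha> i = a \<longrightarrow> \<alpha> j = b \<longrightarrow> c i (z (w j)) = f i j"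
proof -
  obtain z where z: "z \<in> corner a b" "\<forall>(i, j)\<in>pairs a b. c i (z (w j)) = f i j"
    using upper by blast
  obtain l where l: "\<And>i j. i < t \<Longrightarrow> j < t \<Longrightarrow> \<alpha> i = a \<Longrightarrow> \<alpha> j = b \<Longrightarrow> j \<le> i \<Longrightarrow>
      c i (z (w j)) = (if i = j then l else 0)"
    using corner_coordinates[OF a b z(1)] by blast
  have up: "c i (z (w j)) = f i j" if "i < t" "j < t" "\<alpha> i = a" "\<alpha> j = b" "i < j" for i j
    using z(2) that by (auto simp: pairs_def)
  show ?thesis
  proof (cases "a = b \<and> (\<exists>i<t. \<alpha> i = a)")
    case True
    then obtain i0 where i0: "i0 < t" "\<alpha> i0 = a" by blast
    \<comment> \<open>\<open>l\<close> is the diagonal value of the \<open>z\<close> found for the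
      upper part; \<open>k\<close> corrects it to the prescribed one.\<close>
    define k where "k = f i0 i0 - l"
    let ?z = "\<lambda>v. z v + k *s a v"
    have zc: "?z \<in> corner a b"
      using z(1) True corner_add[OF A_L[OF a]] corner_scale[OF A_L[OF a] A_corner[OF a]] by blast
    have "c i (?z (w j)) = f i j" if "i < t" "j < t" "\<alpha> i = a" "\<alpha> j = b" for i j
    proof -
      have "a (w j) = w j" using \<alpha>_w[OF that(2)] that True by simp
      then have "c i (?z (w j)) = c i (z (w j)) + k * (if i = j then 1 else 0)"
        using c_add[OF that(1)] c_scale[OF that(1)] c_w[OF that(1,2)] by simp
      then show ?thesis
        using up[OF that] l[OF that] lower[OF that(1) _ that(3,4)] diag[OF _ that(1) i0(1) that(3) i0(2)] True
        by (cases i j rule: linorder_cases) (auto simp: k_def)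
    qed
    then show ?thesis using zc by (intro bexI[of _ ?z]) auto
  next
    case False
    \<comment> \<open>Either the labels differ or no index carries \<open>a\<close>, so there is no
      diagonal coordinate to correct.\<close>
    have "c i (z (w j)) = f i j" if "i < t" "j < t" "\<alpha> i = a" "\<alpha> j = b" for i j
      using up[OF that] l[OF that] lower[OF that(1) _ that(3,4)] False that
      by (cases i j rule: linorder_cases) auto
    then show ?thesis using z(1) by blast
  qed
qed

text \<open>\<open>X\<close> corresponds to the family of its compressions to the corners
  \<open>a L b\<close>, one per pair of labels and position \<open>(r, s)\<close>, and these can be
  prescribed independently. \<open>eqs\<close> is chosen before \<open>S\<close>, so the same
  equations serve every matrix.\<close>

lemma reduced_form:
  "\<exists>eqs. \<forall>S :: nat \<Rightarrow> nat \<Rightarrow> nat \<Rightarrow> nat \<Rightarrow> 'a.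
    (\<exists>X\<in>L. \<forall>i<t. \<forall>j<t. \<forall>r<mult (\<alpha> i). \<forall>s<mult (\<alpha> j). coord i r (X (bas j s)) = S i r j s) \<longleftrightarrow>
    (\<forall>i<t. \<forall>j<i. \<forall>r<mult (\<alpha> i). \<forall>s<mult (\<alpha> j). S i r j s = 0) \<and>
    (\<forall>i<t. \<forall>j<t. \<alpha> i = \<alpha> j \<longrightarrow> (\<forall>r<mult (\<alpha> i). \<forall>s<mult (\<alpha> i). S i r i s = S j r j s)) \<and>
    (\<forall>a\<in>A. \<forall>b\<in>A. \<forall>k\<in>set (eqs a b). \<forall>r<mult a. \<forall>s<mult b.
      (\<Sum>(i, j)\<in>pairs a b. k (i, j) * S i r j s) = 0)"
proof -
  define solves where "solves a b cs \<longleftrightarrow>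
    (\<forall>f. (\<exists>z\<in>corner a b. \<forall>(i, j)\<in>pairs a b. c i (z (w j)) = f (i, j)) \<longleftrightarrow>
      (\<forall>k\<in>set cs. (\<Sum>p\<in>pairs a b. k p * f p) = 0))" for a b cs
  define eqs where "eqs a b = (SOME cs. solves a b cs)" for a b
  have solves: "solves a b (eqs a b)" if "a \<in> A" "b \<in> A" for a b
    unfolding eqs_def by (rule someI_ex, unfold solves_def, rule corner_equations[OF that])
  have eqs: "(\<exists>z\<in>corner a b. \<forall>(i, j)\<in>pairs a b. c i (z (w j)) = f (i, j)) \<longleftrightarrow>
      (\<forall>k\<in>set (eqs a b). (\<Sum>p\<in>pairs a b. k p * f p) = 0)" if "a \<in> A" "b \<in> A" for a b f
    using solves[OF that] unfolding solves_def by (rule spec)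
  have "(\<exists>X\<in>L. \<forall>i<t. \<forall>j<t. \<forall>r<mult (\<alpha> i). \<forall>s<mult (\<alpha> j). coord i r (X (bas j s)) = S i r j s) \<longleftrightarrow>
    (\<forall>i<t. \<forall>j<i. \<forall>r<mult (\<alpha> i). \<forall>s<mult (\<alpha> j). S i r j s = 0) \<and>
    (\<forall>i<t. \<forall>j<t. \<alpha> i = \<alpha> j \<longrightarrow> (\<forall>r<mult (\<alpha> i). \<forall>s<mult (\<alpha> i). S i r i s = S j r j s)) \<and>
    (\<forall>a\<in>A. \<forall>b\<in>A. \<forall>k\<in>set (eqs a b). \<forall>r<mult a. \<forall>s<mult b.
      (\<Sum>(i, j)\<in>pairs a b. k (i, j) * S i r j s) = 0)" (is "?ex \<longleftrightarrow> ?low \<and> ?dia \<and> ?eqs") for S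
  proof
    assume ?ex
    then obtain X where X: "X \<in> L" "\<And>i j r s. i < t \<Longrightarrow> j < t \<Longrightarrow> r < mult (\<alpha> i) \<Longrightarrow> s < mult (\<alpha> j) \<Longrightarrow>
        coord i r (X (bas j s)) = S i r j s" by blast
    \<comment> \<open>This is the compression of \<open>X\<close> at position \<open>(r, s)\<close>,
      carried to the representatives.\<close>
    define Z where "Z a b r s = (\<lambda>v. x (enum a r) (X (y (enum b s) v)))" for a b r s
    have XE: "X \<in> corner E E"
      using X(1) E_left[OF X(1)] E_right[OF X(1)] by (simp add: corner_def)
    have Zc: "Z a b r s \<in> corner a b" if "r < mult a" "s < mult b" for a b r s
      unfolding Z_def
      using corner_comp[OF x_corner[OF enum_in(1)[OF that(1)]]
          corner_comp[OF XE y_corner[OF enum_in(1)[OF that(2)]]]]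
      by (simp only: enum_in(2)[OF that(1)] enum_in(2)[OF that(2)])
    have S: "S i r j s = c i (Z (\<alpha> i) (\<alpha> j) r s (w j))"
      if "i < t" "j < t" "r < mult (\<alpha> i)" "s < mult (\<alpha> j)" for i j r s
      using X(2)[OF that] by (simp add: coord_def bas_def Z_def)
    have tri: "\<exists>l. \<forall>i<t. \<forall>j<t. \<alpha> i = a \<longrightarrow> \<alpha> j = b \<longrightarrow> j \<le> i \<longrightarrow> S i r j s = (if i = j then l else 0)"
      if ab: "a \<in> A" "b \<in> A" "r < mult a" "s < mult b" for a b r s
    proof -
      obtain l where "\<And>i j. i < t \<Longrightarrow> j < t \<Longrightarrow> \<alpha> i = a \<Longrightarrow> \<alpha> j = b \<Longrightarrow> j \<le> i \<Longrightarrow>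
          c i (Z a b r s (w j)) = (if i = j then l else 0)"
        using corner_coordinates[OF ab(1,2) Zc[OF ab(3,4)]] by blast
      then show ?thesis using S ab(3,4) by (intro exI[of _ l]) auto
    qed
    have ?low
    proof (intro allI impI)
      fix i j r s assume as: "i < t" "j < i" "r < mult (\<alpha> i)" "s < mult (\<alpha> j)"
      then have "j < t" by simp
      then show "S i r j s = 0"
        using tri[OF \<alpha>_in_A[OF as(1)] \<alpha>_in_A[OF \<open>j < t\<close>] as(3,4)] as by (metis less_imp_le less_irrefl)
    qed
    moreover have ?dia
    proof (intro allI impI)
      fix i j r s assume as: "i < t" "j < t" "\<alpha> i = \<alpha> j" "r < mult (\<alpha> i)" "s < mult (\<alpha> i)"
      then show "S i r i s = S j r j s"
        using tri[OF \<alpha>_in_A[OF as(1)] \<alpha>_in_A[OF as(1)] as(4,5)] by (metis order.refl)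
    qed
    moreover have ?eqs
    proof (intro ballI allI impI)
      fix a b k r s assume as: "a \<in> A" "b \<in> A" "k \<in> set (eqs a b)" "r < mult a" "s < mult b"
      have "\<forall>(i, j)\<in>pairs a b. c i (Z a b r s (w j)) = (\<lambda>(i, j). S i r j s) (i, j)"
        using S as(4,5) by (auto simp: pairs_def)
      then have "(\<Sum>p\<in>pairs a b. k p * (\<lambda>(i, j). S i r j s) p) = 0"
        using eqs[OF as(1,2), of "\<lambda>(i, j). S i r j s"] Zc[OF as(4,5)] as(3) by blast
      then show "(\<Sum>(i, j)\<in>pairs a b. k (i, j) * S i r j s) = 0"
        by (simp add: case_prod_beta)
    qed
    ultimately show "?low \<and> ?dia \<and> ?eqs" by blast
  next
    assume conds: "?low \<and> ?dia \<and> ?eqs"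
    have "\<exists>z\<in>corner a b. \<forall>i<t. \<forall>j<t. \<alpha> i = a \<longrightarrow> \<alpha> j = b \<longrightarrow> c i (z (w j)) = S i r j s"
      if ab: "a \<in> A" "b \<in> A" "r < mult a" "s < mult b" for a b r s
    proof (rule corner_interpolation[OF ab(1,2)])
      show "S i r j s = 0" if "i < t" "j < i" "\<alpha> i = a" "\<alpha> j = b" for i j
        using conds that ab by blast
      show "S i r i s = S j r j s" if "a = b" "i < t" "j < t" "\<alpha> i = a" "\<alpha> j = a" for i j
        using conds that ab by metis
      have "(\<Sum>p\<in>pairs a b. k p * (\<lambda>(i, j). S i r j s) p) = 0" if "k \<in> set (eqs a b)" for k
        using conds that ab by (simp add: case_prod_beta)
      then have "\<exists>z\<in>corner a b. \<forall>(i, j)\<in>pairs a b. c i (z (w j)) = (\<lambda>(i, j). S i r j s) (i, j)"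
        using eqs[OF ab(1,2), of "\<lambda>(i, j). S i r j s"] by blast
      then show "\<exists>z\<in>corner a b. \<forall>(i, j)\<in>pairs a b. c i (z (w j)) = S i r j s"
        by simp
    qed
    then have "\<forall>a b r s. \<exists>z. a \<in> A \<longrightarrow> b \<in> A \<longrightarrow> r < mult a \<longrightarrow> s < mult b \<longrightarrow>
        z \<in> corner a b \<and> (\<forall>i<t. \<forall>j<t. \<alpha> i = a \<longrightarrow> \<alpha> j = b \<longrightarrow> c i (z (w j)) = S i r j s)"
      by blast
    then obtain Z where Z: "\<And>a b r s. a \<in> A \<Longrightarrow> b \<in> A \<Longrightarrow> r < mult a \<Longrightarrow> s < mult b \<Longrightarrow>
        Z a b r s \<in> corner a b \<and> (\<forall>i<t. \<forall>j<t. \<alpha> i = a \<longrightarrow> \<alpha> j = b \<longrightarrow> c i (Z a b r s (w j)) = S i r j s)"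
      unfolding choice_iff by blast
    define Y where "Y p q = Z (\<rho> p) (\<rho> q) (idx p) (idx q)" for p q
    have Yc: "Y p q \<in> corner (\<rho> p) (\<rho> q)" if "p \<in> F" "q \<in> F" for p q
      unfolding Y_def using Z[OF \<rho>_in_A[OF that(1)] \<rho>_in_A[OF that(2)] idx_less[OF that(1)] idx_less[OF that(2)]]
      by blast
    \<comment> \<open>This inverts the compression: orthogonality of \<open>x p\<close> and
      \<open>y q\<close> for \<open>p \<noteq> q\<close> isolates the wanted term at each
      position.\<close>
    define X where "X = (\<lambda>v. \<Sum>p\<in>F. \<Sum>q\<in>F. y p (Y p q (x q v)))"
    have "X \<in> L"
      unfolding X_def
      by (intro L_sum L_comp[OF cornerD(1)[OF y_corner] L_comp[OF cornerD(1)[OF Yc] cornerD(1)[OF x_corner]]])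
    moreover have "coord i r (X (bas j s)) = S i r j s"
      if "i < t" "j < t" "r < mult (\<alpha> i)" "s < mult (\<alpha> j)" for i j r s
    proof -
      let ?p = "enum (\<alpha> i) r" and ?q = "enum (\<alpha> j) s"
      have pq: "?p \<in> F" "?q \<in> F" "\<rho> ?p = \<alpha> i" "\<rho> ?q = \<alpha> j" "idx ?p = r" "idx ?q = s"
        using enum_in idx_enum that by blast+
      have q: "(\<Sum>q\<in>F. y p (Y p q (x q (bas j s)))) = y p (Y p ?q (w j))" if p: "p \<in> F" for p
      proof -
        have "y p (Y p q (x q (bas j s))) = (if q = ?q then y p (Y p ?q (w j)) else 0)" if q: "q \<in> F" for q
        proof (cases "q = ?q")
          case True
          then have "x q (bas j s) = w j"
            unfolding bas_def using x_y[OF pq(2)] pq(4) \<alpha>_w[OF \<open>j < t\<close>] by simp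
          then show ?thesis using True by simp
        next
          case False
          then have "x q (bas j s) = 0" unfolding bas_def using x_y_orthogonal[OF q pq(2)] by simp
          then show ?thesis
            using False endo_zero[OF corner_endo[OF Yc[OF p q]]] endo_zero[OF y_endo[OF p]] by simp
        qed
        then have "(\<Sum>q\<in>F. y p (Y p q (x q (bas j s)))) = (\<Sum>q\<in>F. if q = ?q then y p (Y p ?q (w j)) else 0)"
          by (rule sum.cong[OF refl])
        then show ?thesis using pq(2) finite_F by simp
      qed
      have "x ?p (X (bas j s)) = x ?p (\<Sum>p\<in>F. y p (Y p ?q (w j)))"
        unfolding X_def by (simp add: q)
      also have "\<dots> = (\<Sum>p\<in>F. x ?p (y p (Y p ?q (w j))))"
        by (rule endo_sum[OF x_endo[OF pq(1)]])
      also have "\<dots> = (\<Sum>p\<in>F. if p = ?p then Y ?p ?q (w j) else 0)"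
      proof (rule sum.cong[OF refl])
        fix p assume p: "p \<in> F"
        show "x ?p (y p (Y p ?q (w j))) = (if p = ?p then Y ?p ?q (w j) else 0)"
          using x_y[OF pq(1), of "Y ?p ?q (w j)"] cornerD(2)[OF Yc[OF pq(1,2)], of "w j"]
            x_y_orthogonal[OF pq(1) p, of "Y p ?q (w j)"] by auto
      qed
      also have "\<dots> = Y ?p ?q (w j)" using pq(1) finite_F by simp
      also have "\<dots> = Z (\<alpha> i) (\<alpha> j) r s (w j)" by (simp add: Y_def pq)
      finally have "coord i r (X (bas j s)) = c i (Z (\<alpha> i) (\<alpha> j) r s (w j))"
        by (simp add: coord_def)
      then show ?thesis using Z[OF \<alpha>_in_A[OF that(1)] \<alpha>_in_A[OF that(2)] that(3,4)] that by simp
    qed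
    ultimately show ?ex by (intro bexI[of _ X]) auto
  qed
  then show ?thesis by blast
qed

end

section \<open>Block indices\<close>

lemma blk_start_append: "i \<le> length ns \<Longrightarrow> blk_start (ns @ ms) i = blk_start ns i"
  by (simp add: blk_start_def)

lemma blk_start_length: "blk_start ns (length ns) = sum_list ns"
  by (simp add: blk_start_def)

lemma sum_lessThan_plus:
  fixes g :: "nat \<Rightarrow> 'a::comm_monoid_add"
  shows "(\<Sum>k<m + n. g k) = (\<Sum>k<m. g k) + (\<Sum>r<n. g (m + r))"
  by (induction n) (simp_all add: add.assoc)

lemma sum_blocks:
  fixes g :: "nat \<Rightarrow> 'a::comm_monoid_add"
  shows "(\<Sum>k<sum_list ns. g k) = (\<Sum>i<length ns. \<Sum>r<ns ! i. g (blk_start ns i + r))"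
proof (induction ns rule: rev_induct)
  case (snoc n ns)
  have "(\<Sum>i<length ns. \<Sum>r<(ns @ [n]) ! i. g (blk_start (ns @ [n]) i + r)) =
      (\<Sum>i<length ns. \<Sum>r<ns ! i. g (blk_start ns i + r))"
    by (intro sum.cong) (auto simp: nth_append blk_start_append)
  then show ?case
    using snoc by (simp add: sum_lessThan_plus blk_start_append blk_start_length)
qed simp

lemma blk_start_Suc: "i < length ns \<Longrightarrow> blk_start ns (Suc i) = blk_start ns i + ns ! i"
  by (simp add: blk_start_def take_Suc_conv_app_nth)

lemma blk_start_mono:
  assumes "i \<le> j"
  shows "blk_start ns i \<le> blk_start ns j"
proof -
  have "take j ns = take i ns @ take (j - i) (drop i ns)"
    using assms by (metis le_add_diff_inverse take_add)
  then show ?thesis by (simp add: blk_start_def)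
qed

lemma blk_index_less:
  assumes "i < length ns" "r < ns ! i"
  shows "blk_start ns i + r < sum_list ns"
  using blk_start_Suc[OF assms(1)] blk_start_mono[of "Suc i" "length ns" ns] assms
  by (simp add: blk_start_length)

lemma blk_index_inj:
  assumes "i < length ns" "r < ns ! i" "j < length ns" "s < ns ! j"
    and eq: "blk_start ns i + r = blk_start ns j + s"
  shows "i = j \<and> r = s"
proof -
  have *: False if "i < j" "i < length ns" "r < ns ! i" "blk_start ns i + r = blk_start ns j + s" for i j r s
    using blk_start_Suc[OF that(2)] blk_start_mono[of "Suc i" j ns] that by simp
  then have "i = j" using *[OF _ assms(1,2) eq] *[OF _ assms(3,4) eq[symmetric]] by (meson linorder_neqE_nat)
  then show ?thesis using eq by simp
qed

lemma blk_index_cover: "k < sum_list ns \<Longrightarrow> \<exists>i<length ns. \<exists>r<ns ! i. k = blk_start ns i + r"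
proof (induction ns rule: rev_induct)
  case (snoc n ns)
  show ?case
  proof (cases "k < sum_list ns")
    case True
    then obtain i r where "i < length ns" "r < ns ! i" "k = blk_start ns i + r" using snoc.IH by blast
    then show ?thesis by (intro exI[of _ i] conjI exI[of _ r]) (auto simp: nth_append blk_start_append)
  next
    case False
    then show ?thesis
      using snoc.prems
      by (intro exI[of _ "length ns"] conjI exI[of _ "k - sum_list ns"])
         (auto simp: blk_start_append blk_start_length)
  qed
qed simp

definition blk_of :: "nat list \<Rightarrow> nat \<Rightarrow> nat \<times> nat" where
  "blk_of ns k = (SOME (i, r). i < length ns \<and> r < ns ! i \<and> k = blk_start ns i + r)"

lemma blk_of_eq:
  assumes "i < length ns" "r < ns ! i"
  shows "blk_of ns (blk_start ns i + r) = (i, r)"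
  unfolding blk_of_def by (rule some_equality) (use assms blk_index_inj in auto)

section \<open>Matrices as operators\<close>

lemma sum_fun_apply: "(\<Sum>k\<in>K. f k) i = (\<Sum>k\<in>K. f k i)"
  by (induction K rule: infinite_finite_induct) auto

context linear_operators
begin

lemma functional_sum:
  assumes "\<And>u v. d (u + v) = d u + d v" "\<And>k v. d (k *s v) = k * d v"
  shows "d (\<Sum>k\<in>K. f k) = (\<Sum>k\<in>K. d (f k))"
proof -
  have "d 0 = 0" using assms(2)[of 0 0] by simp
  then show ?thesis by (induction K rule: infinite_finite_induct) (auto simp: assms)
qed

text \<open>A family with dual functionals is independent. Applied in both directions, this shows
  that the transported basis has exactly \<open>n\<close> members.\<close>

lemma dual_family_card_le:
  fixes b :: "nat \<Rightarrow> 'b" and d :: "nat \<Rightarrow> 'b \<Rightarrow> 'a"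
  assumes add: "\<And>k u v. k < N \<Longrightarrow> d k (u + v) = d k u + d k v"
    and scale: "\<And>k c v. k < N \<Longrightarrow> d k (c *s v) = c * d k v"
    and dual: "\<And>k l. k < N \<Longrightarrow> l < N \<Longrightarrow> d k (b l) = (if k = l then 1 else 0)"
    and S: "finite S" "\<And>k. k < N \<Longrightarrow> b k \<in> span S"
  shows "N \<le> card S"
proof -
  have inj: "inj_on b {..<N}"
    by (rule inj_onI) (metis dual lessThan_iff zero_neq_one)
  have "u (b k) = 0" if eq: "(\<Sum>v\<in>b ` {..<N}. u v *s v) = 0" and k: "k < N" for u k
  proof -
    have "0 = d k (\<Sum>l<N. u (b l) *s b l)"
      using eq scale[OF k, of 0 0] by (simp add: sum.reindex[OF inj])
    also have "\<dots> = (\<Sum>l<N. u (b l) * d k (b l))"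
      by (simp add: functional_sum[of "d k"] add[OF k] scale[OF k])
    also have "\<dots> = (\<Sum>l<N. if k = l then u (b l) else 0)"
      by (intro sum.cong) (auto simp: dual[OF k])
    also have "\<dots> = u (b k)" using k by simp
    finally show ?thesis by simp
  qed
  then have "independent (b ` {..<N})"
    by (subst dependent_finite) auto
  then have "card (b ` {..<N}) \<le> card S"
    using independent_span_bound[OF S(1)] S(2) by blast
  then show ?thesis by (simp add: card_image[OF inj])
qed

end

text \<open>The type of vectors cannot depend on \<open>n\<close>, so \<open>k^n\<close> is taken as
  the functions vanishing from \<open>n\<close> on; the truncation makes the unit matrix act as the
  projection onto them.\<close>

definition mat_op :: "nat \<Rightarrow> 'a::field mat \<Rightarrow> (nat \<Rightarrow> 'a) \<Rightarrow> (nat \<Rightarrow> 'a)" where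
  "mat_op n M v = (\<lambda>i. if i < n then (\<Sum>j<n. M $$ (i, j) * v j) else 0)"

lemma mat_op_mult:
  assumes "M \<in> carrier_mat n n" "N \<in> carrier_mat n n"
  shows "mat_op n (M * N) v = mat_op n M (mat_op n N v)"
proof (rule ext)
  fix i
  show "mat_op n (M * N) v i = mat_op n M (mat_op n N v) i"
  proof (cases "i < n")
    case True
    have "mat_op n (M * N) v i = (\<Sum>j<n. \<Sum>k<n. M $$ (i, k) * N $$ (k, j) * v j)"
      using assms True
      by (auto simp: mat_op_def scalar_prod_def atLeast0LessThan sum_distrib_right intro!: sum.cong)
    also have "\<dots> = (\<Sum>k<n. \<Sum>j<n. M $$ (i, k) * N $$ (k, j) * v j)"
      by (rule sum.swap)
    also have "\<dots> = mat_op n M (mat_op n N v) i"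
      using True by (simp add: mat_op_def sum_distrib_left mult.assoc)
    finally show ?thesis .
  qed (simp add: mat_op_def)
qed

lemma mat_op_one: "mat_op n (1\<^sub>m n) v = (\<lambda>i. if i < n then v i else 0)"
proof (rule ext)
  fix i
  show "mat_op n (1\<^sub>m n) v i = (if i < n then v i else 0)"
  proof (cases "i < n")
    case True
    have "(\<Sum>j<n. 1\<^sub>m n $$ (i, j) * v j) = (\<Sum>j<n. if i = j then v j else 0)"
      by (intro sum.cong) (use True in auto)
    then show ?thesis using True by (simp add: mat_op_def)
  qed (simp add: mat_op_def)
qed

abbreviation fun_scale :: "'a::field \<Rightarrow> (nat \<Rightarrow> 'a) \<Rightarrow> (nat \<Rightarrow> 'a)" where
  "fun_scale k v \<equiv> (\<lambda>i. k * v i)"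

definition unit_fun :: "nat \<Rightarrow> nat \<Rightarrow> 'a::field" where
  "unit_fun i = (\<lambda>j. if j = i then 1 else 0)"

lemma fun_vector_space: "vector_space fun_scale"
  by unfold_locales (auto simp: fun_eq_iff algebra_simps)

lemma unit_fun_expand:
  fixes v :: "nat \<Rightarrow> 'a::field"
  assumes "\<And>i. n \<le> i \<Longrightarrow> v i = 0"
  shows "v = (\<Sum>i<n. fun_scale (v i) (unit_fun i))"
proof (rule ext)
  fix j
  have "(\<Sum>i<n. fun_scale (v i) (unit_fun i)) j = (\<Sum>i<n. if j = i then v i else 0)"
    unfolding sum_fun_apply by (intro sum.cong) (auto simp: unit_fun_def)
  also have "\<dots> = v j" using assms[of j] by (cases "j < n") auto
  finally show "v j = (\<Sum>i<n. fun_scale (v i) (unit_fun i)) j" by simp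
qed

lemma mat_op_algebra:
  fixes L :: "'a::alg_closed_field mat set"
  assumes "matrix_algebra n L"
  shows "operator_algebra fun_scale (mat_op n ` L) (mat_op n (1\<^sub>m n))"
proof -
  interpret V: linear_operators "fun_scale :: 'a \<Rightarrow> _"
    by (simp add: linear_operators_def fun_vector_space)
  have L: "L \<subseteq> carrier_mat n n" "0\<^sub>m n n \<in> L" "1\<^sub>m n \<in> L"
    "\<And>M N. M \<in> L \<Longrightarrow> N \<in> L \<Longrightarrow> M + N \<in> L" "\<And>k M. M \<in> L \<Longrightarrow> k \<cdot>\<^sub>m M \<in> L"
    "\<And>M N. M \<in> L \<Longrightarrow> N \<in> L \<Longrightarrow> M * N \<in> L"
    using assms by (auto simp: matrix_algebra_def)
  have car: "M \<in> carrier_mat n n" if "M \<in> L" for M using L(1) that by blast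
  show ?thesis
  proof
    fix f g :: "(nat \<Rightarrow> 'a) \<Rightarrow> nat \<Rightarrow> 'a" and k :: 'a and v
    assume "f \<in> mat_op n ` L"
    then obtain M where M: "M \<in> L" "f = mat_op n M" by blast
    show "V.endo f"
      unfolding V.endo_def M(2) mat_op_def
      by (auto simp: fun_eq_iff algebra_simps sum.distrib sum_distrib_left)
    show "(\<lambda>v. fun_scale k (f v)) \<in> mat_op n ` L"
      using L(5)[OF M(1), of k] car[OF M(1)] unfolding M(2)
      by (intro image_eqI[of _ _ "k \<cdot>\<^sub>m M"])
         (auto simp: fun_eq_iff mat_op_def sum_distrib_left mult.assoc intro!: sum.cong)
    show "mat_op n (1\<^sub>m n) (f v) = f v"
      unfolding mat_op_one M(2) by (auto simp: mat_op_def)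
    show "f (mat_op n (1\<^sub>m n) v) = f v"
      unfolding mat_op_one M(2) by (auto simp: mat_op_def fun_eq_iff)
    assume "g \<in> mat_op n ` L"
    then obtain N where N: "N \<in> L" "g = mat_op n N" by blast
    show "(\<lambda>v. f v + g v) \<in> mat_op n ` L"
      using L(4)[OF M(1) N(1)] car[OF M(1)] car[OF N(1)] unfolding M(2) N(2)
      by (intro image_eqI[of _ _ "M + N"])
         (auto simp: fun_eq_iff mat_op_def sum.distrib[symmetric] algebra_simps intro!: sum.cong)
    show "(\<lambda>v. f (g v)) \<in> mat_op n ` L"
      using L(6)[OF M(1) N(1)] mat_op_mult[OF car[OF M(1)] car[OF N(1)]] unfolding M(2) N(2)
      by (intro image_eqI[of _ _ "M * N"]) auto
  next
    show "(\<lambda>v. 0) \<in> mat_op n ` L"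
      using L(2) by (intro image_eqI[of _ _ "0\<^sub>m n n"]) (auto simp: fun_eq_iff mat_op_def)
    show "mat_op n (1\<^sub>m n) \<in> mat_op n ` L" using L(3) by blast
    have "v \<in> V.span (unit_fun ` {..<n})" if "v \<in> range (mat_op n (1\<^sub>m n))" for v :: "nat \<Rightarrow> 'a"
    proof -
      have "v = (\<Sum>i<n. fun_scale (v i) (unit_fun i))"
        by (rule unit_fun_expand) (use that in \<open>auto simp: mat_op_def\<close>)
      also have "\<dots> \<in> V.span (unit_fun ` {..<n})"
        by (intro V.span_sum V.span_scale V.span_base) auto
      finally show ?thesis .
    qed
    then show "\<exists>S. finite S \<and> range (mat_op n (1\<^sub>m n)) \<subseteq> V.span S"
      by (intro exI[of _ "unit_fun ` {..<n}"]) auto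
  qed
qed


text \<open>The equivalence relation is equality of labels, and the equations of a pair of classes
  are those of their labels.\<close>

lemma reduced_algebraI:
  fixes \<alpha> :: "nat \<Rightarrow> 'c" and mult :: "'c \<Rightarrow> nat" and t :: nat
    and eqs :: "'c \<Rightarrow> 'c \<Rightarrow> (nat \<times> nat \<Rightarrow> 'a::field) list"
  defines "ns \<equiv> map (\<lambda>i. mult (\<alpha> i)) [0..<t]"
    and "pairs \<equiv> \<lambda>a b. {(i, j). i < t \<and> j < t \<and> \<alpha> i = a \<and> \<alpha> j = b \<and> i < j}"
  assumes \<alpha>: "\<And>i. i < t \<Longrightarrow> \<alpha> i \<in> A"
    and L: "L = {S \<in> carrier_mat (sum_list ns) (sum_list ns).
      (\<forall>i<t. \<forall>j<i. \<forall>r<mult (\<alpha> i). \<forall>s<mult (\<alpha> j). S $$ (blk_start ns i + r, blk_start ns j + s) = 0) \<and>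
      (\<forall>i<t. \<forall>j<t. \<alpha> i = \<alpha> j \<longrightarrow> (\<forall>r<mult (\<alpha> i). \<forall>s<mult (\<alpha> i).
        S $$ (blk_start ns i + r, blk_start ns i + s) = S $$ (blk_start ns j + r, blk_start ns j + s))) \<and>
      (\<forall>a\<in>A. \<forall>b\<in>A. \<forall>k\<in>set (eqs a b). \<forall>r<mult a. \<forall>s<mult b.
        (\<Sum>(i, j)\<in>pairs a b. k (i, j) * S $$ (blk_start ns i + r, blk_start ns j + s)) = 0)}"
  shows "reduced_algebra ns L"
proof -
  have len: "length ns = t" and nth: "\<And>i. i < t \<Longrightarrow> ns ! i = mult (\<alpha> i)"
    by (simp_all add: ns_def)
  define R where "R = {(i, j). i < t \<and> j < t \<and> \<alpha> i = \<alpha> j}"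
  \<comment> \<open>All members of a class carry the same label, so any choice of member will
    do.\<close>
  define lab where "lab I = \<alpha> (SOME i. i \<in> I)" for I
  define eqs' where "eqs' I J = map (\<lambda>k i j. k (i, j)) (eqs (lab I) (lab J))" for I J
  have R: "equiv {0..<t} R"
    by (auto simp: equiv_def refl_on_def sym_def trans_def R_def)
  have cls: "R `` {i} = {i'. i' < t \<and> \<alpha> i' = \<alpha> i}" if "i < t" for i
    using that by (auto simp: R_def)
  have lab: "lab (R `` {i}) = \<alpha> i" if "i < t" for i
  proof -
    have "(SOME i'. i' \<in> R `` {i}) \<in> R `` {i}"
      by (rule someI[of _ i]) (simp add: cls[OF that] that)
    then show ?thesis by (simp add: lab_def cls[OF that])
  qed
  have "(\<forall>i<t. \<forall>j<t. j < i \<longrightarrow> block ns S i j = 0\<^sub>m (ns ! i) (ns ! j)) \<longleftrightarrow>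
      (\<forall>i<t. \<forall>j<i. \<forall>r<mult (\<alpha> i). \<forall>s<mult (\<alpha> j). S $$ (blk_start ns i + r, blk_start ns j + s) = 0)"
    for S :: "'a mat"
    by (auto simp: block_def mat_eq_iff nth)
  moreover have "(\<forall>(i, j)\<in>R. block ns S i i = block ns S j j) \<longleftrightarrow>
      (\<forall>i<t. \<forall>j<t. \<alpha> i = \<alpha> j \<longrightarrow> (\<forall>r<mult (\<alpha> i). \<forall>s<mult (\<alpha> i).
        S $$ (blk_start ns i + r, blk_start ns i + s) = S $$ (blk_start ns j + r, blk_start ns j + s)))"
    for S :: "'a mat"
    by (auto simp: block_def mat_eq_iff nth R_def)
  moreover have "(\<forall>I\<in>{0..<t} // R. \<forall>J\<in>{0..<t} // R. \<forall>k\<in>set (eqs' I J).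
        \<forall>i0\<in>I. \<forall>j0\<in>J. \<forall>r<ns ! i0. \<forall>s<ns ! j0.
          (\<Sum>(i, j)\<in>{(i, j). i \<in> I \<and> j \<in> J \<and> i < j}.
            k i j * S $$ (blk_start ns i + r, blk_start ns j + s)) = 0) \<longleftrightarrow>
      (\<forall>a\<in>A. \<forall>b\<in>A. \<forall>k\<in>set (eqs a b). \<forall>r<mult a. \<forall>s<mult b.
        (\<Sum>(i, j)\<in>pairs a b. k (i, j) * S $$ (blk_start ns i + r, blk_start ns j + s)) = 0)"
    (is "?l \<longleftrightarrow> ?r") for S :: "'a mat"
  proof
    assume l: ?l
    show ?r
    proof (intro ballI allI impI)
      fix a b k r s assume as: "a \<in> A" "b \<in> A" "k \<in> set (eqs a b)" "r < mult a" "s < mult b"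
      show "(\<Sum>(i, j)\<in>pairs a b. k (i, j) * S $$ (blk_start ns i + r, blk_start ns j + s)) = 0"
      \<comment> \<open>If no index pair carries these labels the sum is empty; otherwise such a
        pair determines the two classes whose equations apply.\<close>
      proof (cases "pairs a b = {}")
        case False
        then obtain i0 j0 where ij: "i0 < t" "j0 < t" "\<alpha> i0 = a" "\<alpha> j0 = b" by (auto simp: pairs_def)
        let ?I = "R `` {i0}" and ?J = "R `` {j0}"
        have IJ: "?I \<in> {0..<t} // R" "?J \<in> {0..<t} // R" using ij by (auto intro: quotientI)
        have k: "(\<lambda>i j. k (i, j)) \<in> set (eqs' ?I ?J)"
          using as(3) by (auto simp: eqs'_def lab ij)
        have mem: "i0 \<in> ?I" "j0 \<in> ?J" "r < ns ! i0" "s < ns ! j0"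
          using as ij by (simp_all add: cls nth)
        have "(\<Sum>(i, j)\<in>{(i, j). i \<in> ?I \<and> j \<in> ?J \<and> i < j}.
            k (i, j) * S $$ (blk_start ns i + r, blk_start ns j + s)) = 0"
          by (rule l[rule_format, OF IJ k mem])
        moreover have "{(i, j). i \<in> ?I \<and> j \<in> ?J \<and> i < j} = pairs a b"
          using ij by (auto simp: cls pairs_def)
        ultimately show ?thesis by simp
      qed simp
    qed
  next
    assume r: ?r
    show ?l
    proof (intro ballI allI impI)
      fix I J k i0 j0 r s
      assume as: "I \<in> {0..<t} // R" "J \<in> {0..<t} // R" "k \<in> set (eqs' I J)" "i0 \<in> I" "j0 \<in> J"
        "r < ns ! i0" "s < ns ! j0"
      obtain i where i: "i < t" "I = R `` {i}" using as(1) by (auto elim: quotientE)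
      obtain j where j: "j < t" "J = R `` {j}" using as(2) by (auto elim: quotientE)
      have "r < mult (\<alpha> i)" "s < mult (\<alpha> j)"
        using as(4-7) cls[OF i(1)] cls[OF j(1)] nth i j by auto
      moreover obtain k' where k': "k' \<in> set (eqs (\<alpha> i) (\<alpha> j))" "k = (\<lambda>i j. k' (i, j))"
        using as(3) by (auto simp: eqs'_def i j lab)
      moreover have "{(i, j). i \<in> I \<and> j \<in> J \<and> i < j} = pairs (\<alpha> i) (\<alpha> j)"
        unfolding i(2) j(2) cls[OF i(1)] cls[OF j(1)] pairs_def by auto
      ultimately show "(\<Sum>(i, j)\<in>{(i, j). i \<in> I \<and> j \<in> J \<and> i < j}.
            k i j * S $$ (blk_start ns i + r, blk_start ns j + s)) = 0"
        using r \<alpha>[OF i(1)] \<alpha>[OF j(1)] by simp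
    qed
  qed
  ultimately have "L = {S \<in> carrier_mat (sum_list ns) (sum_list ns).
      (\<forall>i<t. \<forall>j<t. j < i \<longrightarrow> block ns S i j = 0\<^sub>m (ns ! i) (ns ! j)) \<and>
      (\<forall>(i, j)\<in>R. block ns S i i = block ns S j j) \<and>
      (\<forall>I\<in>{0..<t} // R. \<forall>J\<in>{0..<t} // R. \<forall>k\<in>set (eqs' I J).
        \<forall>i0\<in>I. \<forall>j0\<in>J. \<forall>r<ns ! i0. \<forall>s<ns ! j0.
          (\<Sum>(i, j)\<in>{(i, j). i \<in> I \<and> j \<in> J \<and> i < j}.
            k i j * S $$ (blk_start ns i + r, blk_start ns j + s)) = 0)}"
    unfolding L by (simp only:)
  moreover have "\<forall>(i, j)\<in>R. ns ! i = ns ! j" by (auto simp: R_def nth)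
  ultimately show ?thesis
    unfolding reduced_algebra_def Let_def len using R by (intro exI[of _ R] exI[of _ eqs'] conjI)
qed


lemma (in operator_algebra) nonisomorphic_representatives:
  assumes "matrix_units F \<rho> x y"
  shows "nonisomorphic_idempotents scale L E (\<rho> ` F)"
proof
  have dec: "primitive_decomposition F E" and sub: "\<rho> ` F \<subseteq> F"
    and noniso: "\<And>a b. a \<in> \<rho> ` F \<Longrightarrow> b \<in> \<rho> ` F \<Longrightarrow> a \<noteq> b \<Longrightarrow> \<not> iso a b"
    using assms unfolding matrix_units_def by blast+
  fix a b v assume a: "a \<in> \<rho> ` F"
  show "primitive a" using primitive_decompositionD(2)[OF dec] a sub by blast
  assume b: "b \<in> \<rho> ` F" and ab: "a \<noteq> b"
  show "\<not> iso a b" by (rule noniso[OF a b ab])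
  show "a (b v) = 0"
    by (rule primitive_decompositionD(4)[OF dec subsetD[OF sub a] subsetD[OF sub b] ab])
qed

theorem theorem1p1:
  fixes L :: "'a::alg_closed_field mat set" and n :: nat
  assumes "matrix_algebra n L"
  shows "\<exists>P Pinv. P \<in> carrier_mat n n \<and> Pinv \<in> carrier_mat n n \<and>
           P * Pinv = 1\<^sub>m n \<and> Pinv * P = 1\<^sub>m n \<and>
           reduced_matrix_algebra {Pinv * A * P | A. A \<in> L}"
proof -
  let ?E = "mat_op n (1\<^sub>m n) :: (nat \<Rightarrow> 'a) \<Rightarrow> nat \<Rightarrow> 'a"
  interpret V: operator_algebra fun_scale "mat_op n ` L" ?E
    by (rule mat_op_algebra[OF assms])
  have car: "M \<in> carrier_mat n n" if "M \<in> L" for M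
    using assms that by (auto simp: matrix_algebra_def)
  obtain F \<rho> x y where units: "V.matrix_units F \<rho> x y"
    using V.matrix_units_exist by blast
  interpret V: nonisomorphic_idempotents fun_scale "mat_op n ` L" ?E "\<rho> ` F"
    by (rule V.nonisomorphic_representatives[OF units])
  obtain t w \<alpha> c where coords: "V.triangular_coordinates t w \<alpha> c"
    using V.triangular_coordinates_exist by blast
  interpret V: matrix_unit_basis fun_scale "mat_op n ` L" ?E "\<rho> ` F" F \<rho> x y t w \<alpha> c
    by unfold_locales (rule units refl coords)+
  define ns where "ns = map (\<lambda>i. V.mult (\<alpha> i)) [0..<t]"
  have len: "length ns = t" and nth: "\<And>i. i < t \<Longrightarrow> ns ! i = V.mult (\<alpha> i)"
    by (simp_all add: ns_def)
  define N where "N = sum_list ns"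
  \<comment> \<open>Block coordinates \<open>(i, r)\<close> are flattened to a single index
    \<open>k\<close>; \<open>b\<close> is the basis and \<open>d\<close> its dual family.\<close>
  define b where "b k = V.bas (fst (blk_of ns k)) (snd (blk_of ns k))" for k
  define d where "d k = V.coord (fst (blk_of ns k)) (snd (blk_of ns k))" for k
  have blk: "blk_of ns (blk_start ns i + r) = (i, r)" if "i < t" "r < V.mult (\<alpha> i)" for i r
    using blk_of_eq that len nth by simp
  have cover: "\<exists>i r. i < t \<and> r < V.mult (\<alpha> i) \<and> k = blk_start ns i + r" if "k < N" for k
    using blk_index_cover[of k ns] that len nth by (auto simp: N_def)
  have b_blk: "b (blk_start ns i + r) = V.bas i r" if "i < t" "r < V.mult (\<alpha> i)" for i r
    by (simp add: b_def blk[OF that])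
  have d_blk: "d (blk_start ns i + r) = V.coord i r" if "i < t" "r < V.mult (\<alpha> i)" for i r
    by (simp add: d_def blk[OF that])
  have d_add: "d k (u + v) = d k u + d k v" if "k < N" for k u v
    using cover[OF that] d_blk V.coord_add by auto
  have d_scale: "d k (fun_scale q v) = q * d k v" if "k < N" for k q v
    using cover[OF that] d_blk V.coord_scale by auto
  have d_sum: "d k (\<Sum>i\<in>I. f i) = (\<Sum>i\<in>I. d k (f i))" if "k < N" for k f and I :: "nat set"
    by (rule V.functional_sum[OF d_add[OF that] d_scale[OF that]])
  have d_b: "d k (b l) = (if k = l then 1 else 0)" if kl: "k < N" "l < N" for k l
  proof -
    obtain i r j s where ir: "i < t" "r < V.mult (\<alpha> i)" "k = blk_start ns i + r"
      and js: "j < t" "s < V.mult (\<alpha> j)" "l = blk_start ns j + s"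
      using cover kl by blast
    have "i = j \<and> r = s \<longleftrightarrow> k = l"
      using blk_index_inj[of i ns r j s] ir js len nth by auto
    then show ?thesis
      unfolding ir(3) js(3) d_blk[OF ir(1,2)] b_blk[OF js(1,2)] V.coord_bas[OF ir(1,2) js(1,2)]
      by simp
  qed
  have E_supp: "?E v = v" if "\<And>i. n \<le> i \<Longrightarrow> v i = 0" for v
    using that by (auto simp: mat_op_one fun_eq_iff)
  have expand: "v = (\<Sum>k<N. fun_scale (d k v) (b k))" if v: "\<And>i. n \<le> i \<Longrightarrow> v i = 0" for v
  proof -
    have "v = ?E v" by (rule E_supp[OF v, symmetric])
    also have "\<dots> = (\<Sum>i<t. \<Sum>r<V.mult (\<alpha> i). fun_scale (V.coord i r v) (V.bas i r))"
      by (rule V.E_expand)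
    also have "\<dots> = (\<Sum>i<t. \<Sum>r<ns ! i. fun_scale (d (blk_start ns i + r) v) (b (blk_start ns i + r)))"
      by (intro sum.cong refl) (auto simp: nth b_blk d_blk)
    also have "\<dots> = (\<Sum>k<N. fun_scale (d k v) (b k))"
      unfolding N_def sum_blocks len by simp
    finally show ?thesis .
  qed
  have b_supp: "b k i = 0" if k: "k < N" and i: "n \<le> i" for k i
  proof -
    obtain j r where jr: "j < t" "r < V.mult (\<alpha> j)" "k = blk_start ns j + r" using cover[OF k] by blast
    have "b k = y (V.enum (\<alpha> j) r) (w j)" using jr b_blk by (simp add: V.bas_def)
    moreover obtain M where "y (V.enum (\<alpha> j) r) = mat_op n M"
      using V.cornerD(1)[OF V.y_corner[OF V.enum_in(1)[OF jr(2)]]] by blast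
    ultimately show ?thesis using i by (simp add: mat_op_def)
  qed
  have unit_supp: "unit_fun i j = 0" if "i < n" "n \<le> j" for i j
    using that by (simp add: unit_fun_def)
  \<comment> \<open>Both inequalities come from dual pairs: here the \<open>b k\<close> inside the
    span of the unit vectors, then the unit vectors inside the span of the
    \<open>b k\<close>.\<close>
  have "N \<le> card ((unit_fun :: nat \<Rightarrow> nat \<Rightarrow> 'a) ` {..<n})"
  proof (rule V.dual_family_card_le[OF d_add d_scale d_b])
    show "b k \<in> V.span (unit_fun ` {..<n})" if "k < N" for k
    proof -
      have "b k = (\<Sum>i<n. fun_scale (b k i) (unit_fun i))"
        by (rule unit_fun_expand) (rule b_supp[OF that])
      also have "\<dots> \<in> V.span (unit_fun ` {..<n})"
        by (intro V.span_sum V.span_scale V.span_base) auto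
      finally show ?thesis .
    qed
  qed auto
  then have "N \<le> n" using card_image_le[of "{..<n}" "unit_fun :: nat \<Rightarrow> nat \<Rightarrow> 'a"] by simp
  moreover have "n \<le> card (b ` {..<N})"
  proof (rule V.dual_family_card_le[where d = "\<lambda>k v. v k" and b = unit_fun])
    show "unit_fun k \<in> V.span (b ` {..<N})" if "k < n" for k
    proof -
      have "unit_fun k = (\<Sum>l<N. fun_scale (d l (unit_fun k)) (b l))"
        by (rule expand) (rule unit_supp[OF that])
      also have "\<dots> \<in> V.span (b ` {..<N})"
        by (intro V.span_sum V.span_scale V.span_base) auto
      finally show ?thesis .
    qed
  qed (auto simp: unit_fun_def)
  then have "n \<le> N" using card_image_le[of "{..<N}" b] by simp
  ultimately have N: "N = n" by simp
  \<comment> \<open>The columns of \<open>P\<close> are the basis vectors; the rows of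
    \<open>Q\<close> are the functionals \<open>d k\<close> evaluated on unit vectors.\<close>
  define P where "P = mat n n (\<lambda>(i, k). b k i)"
  define Q where "Q = mat n n (\<lambda>(k, i). d k (unit_fun i))"
  have PQ_car: "P \<in> carrier_mat n n" "Q \<in> carrier_mat n n" by (simp_all add: P_def Q_def)
  have d_eval: "(\<Sum>i<n. d k (unit_fun i) * v i) = d k v" if k: "k < n" and v: "\<And>i. n \<le> i \<Longrightarrow> v i = 0" for k v
  proof -
    have kN: "k < N" using k N by simp
    have "d k v = d k (\<Sum>i<n. fun_scale (v i) (unit_fun i))" by (rule arg_cong[OF unit_fun_expand[OF v]])
    also have "\<dots> = (\<Sum>i<n. v i * d k (unit_fun i))" by (simp add: d_sum[OF kN] d_scale[OF kN])
    finally show ?thesis by (simp add: mult.commute)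
  qed
  have QP: "Q * P = 1\<^sub>m n"
  proof (rule eq_matI)
    fix k l assume "k < dim_row (1\<^sub>m n)" "l < dim_col (1\<^sub>m n)"
    then have kl: "k < n" "l < n" by simp_all
    have "(Q * P) $$ (k, l) = (\<Sum>i<n. d k (unit_fun i) * b l i)"
      using kl by (simp add: P_def Q_def scalar_prod_def atLeast0LessThan)
    also have "\<dots> = d k (b l)" using d_eval[OF kl(1)] b_supp kl(2) N by simp
    finally show "(Q * P) $$ (k, l) = 1\<^sub>m n $$ (k, l)" using d_b kl N by simp
  qed (simp_all add: P_def Q_def)
  have PQ: "P * Q = 1\<^sub>m n"
  proof (rule eq_matI)
    fix i j assume "i < dim_row (1\<^sub>m n)" "j < dim_col (1\<^sub>m n)"
    then have ij: "i < n" "j < n" by simp_all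
    have "(P * Q) $$ (i, j) = (\<Sum>k<n. b k i * d k (unit_fun j))"
      using ij by (simp add: P_def Q_def scalar_prod_def atLeast0LessThan)
    also have "\<dots> = (\<Sum>k<N. fun_scale (d k (unit_fun j)) (b k)) i"
      by (simp add: sum_fun_apply N mult.commute)
    also have "\<dots> = unit_fun j i" by (rule fun_cong[OF expand[OF unit_supp[OF ij(2)]], symmetric])
    finally show "(P * Q) $$ (i, j) = 1\<^sub>m n $$ (i, j)" using ij by (simp add: unit_fun_def)
  qed (simp_all add: P_def Q_def)
  \<comment> \<open>Conjugation by \<open>P\<close> gives the matrix of the operator in the basis
    \<open>b\<close>, whose entries the functionals \<open>d\<close> read off.\<close>
  have entry: "(Q * M * P) $$ (k, l) = d k (mat_op n M (b l))"
    if M: "M \<in> carrier_mat n n" and kl: "k < n" "l < n" for M k l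
  proof -
    have MP: "(M * P) $$ (i, l) = mat_op n M (b l) i" if "i < n" for i
      using that kl M by (simp add: P_def mat_op_def scalar_prod_def atLeast0LessThan)
    have "(Q * M * P) $$ (k, l) = (Q * (M * P)) $$ (k, l)"
      using assoc_mult_mat[OF PQ_car(2) M PQ_car(1)] by simp
    also have "\<dots> = (\<Sum>i<n. d k (unit_fun i) * (M * P) $$ (i, l))"
      using kl M by (simp add: Q_def P_def scalar_prod_def atLeast0LessThan)
    also have "\<dots> = (\<Sum>i<n. d k (unit_fun i) * mat_op n M (b l) i)"
      by (intro sum.cong refl) (simp add: MP)
    also have "\<dots> = d k (mat_op n M (b l))"
      by (rule d_eval[OF kl(1)]) (simp add: mat_op_def)
    finally show ?thesis .
  qed
  obtain eqs where eqs: "\<And>S :: nat \<Rightarrow> nat \<Rightarrow> nat \<Rightarrow> nat \<Rightarrow> 'a.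
    (\<exists>X\<in>mat_op n ` L. \<forall>i<t. \<forall>j<t. \<forall>r<V.mult (\<alpha> i). \<forall>s<V.mult (\<alpha> j). V.coord i r (X (V.bas j s)) = S i r j s) \<longleftrightarrow>
    (\<forall>i<t. \<forall>j<i. \<forall>r<V.mult (\<alpha> i). \<forall>s<V.mult (\<alpha> j). S i r j s = 0) \<and>
    (\<forall>i<t. \<forall>j<t. \<alpha> i = \<alpha> j \<longrightarrow> (\<forall>r<V.mult (\<alpha> i). \<forall>s<V.mult (\<alpha> i). S i r i s = S j r j s)) \<and>
    (\<forall>a\<in>\<rho> ` F. \<forall>b\<in>\<rho> ` F. \<forall>k\<in>set (eqs a b). \<forall>r<V.mult a. \<forall>s<V.mult b.
      (\<Sum>(i, j)\<in>V.pairs a b. k (i, j) * S i r j s) = 0)"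
    using V.reduced_form by (elim exE) (rule that, erule spec)
  \<comment> \<open>Membership in the conjugated algebra is put in the form of the left-hand side of
    \<open>reduced_form\<close>; the blocks cover all indices, so blockwise equality determines the
    matrix.\<close>
  have mem: "S \<in> {Q * M * P | M. M \<in> L} \<longleftrightarrow> S \<in> carrier_mat n n \<and>
      (\<exists>X\<in>mat_op n ` L. \<forall>i<t. \<forall>j<t. \<forall>r<V.mult (\<alpha> i). \<forall>s<V.mult (\<alpha> j).
        V.coord i r (X (V.bas j s)) = S $$ (blk_start ns i + r, blk_start ns j + s))" for S
  proof -
    have "S = Q * M * P \<longleftrightarrow> S \<in> carrier_mat n n \<and>
        (\<forall>i<t. \<forall>j<t. \<forall>r<V.mult (\<alpha> i). \<forall>s<V.mult (\<alpha> j).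
          V.coord i r (mat_op n M (V.bas j s)) = S $$ (blk_start ns i + r, blk_start ns j + s))"
      (is "_ \<longleftrightarrow> _ \<and> ?entries") if M: "M \<in> carrier_mat n n" for M
    proof -
      have lt: "blk_start ns i + r < n" if "i < t" "r < V.mult (\<alpha> i)" for i r
        using blk_index_less[of i ns r] that len nth N by (simp add: N_def)
      have blk_entry: "(Q * M * P) $$ (blk_start ns i + r, blk_start ns j + s) =
          V.coord i r (mat_op n M (V.bas j s))"
        if "i < t" "r < V.mult (\<alpha> i)" "j < t" "s < V.mult (\<alpha> j)" for i r j s
        using entry[OF M lt[OF that(1,2)] lt[OF that(3,4)]] b_blk[OF that(3,4)] d_blk[OF that(1,2)] by simp
      have car': "Q * M * P \<in> carrier_mat n n" using PQ_car M by simp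
      show ?thesis
      proof
        assume "S = Q * M * P"
        then show "S \<in> carrier_mat n n \<and> ?entries" using car' blk_entry by simp
      next
        assume S: "S \<in> carrier_mat n n \<and> ?entries"
        show "S = Q * M * P"
        proof (rule eq_matI)
          fix k l assume "k < dim_row (Q * M * P)" "l < dim_col (Q * M * P)"
          then have "k < N" "l < N" using PQ_car M N by simp_all
          then obtain i r j s where "i < t" "r < V.mult (\<alpha> i)" "k = blk_start ns i + r"
            "j < t" "s < V.mult (\<alpha> j)" "l = blk_start ns j + s"
            using cover by blast
          then show "S $$ (k, l) = (Q * M * P) $$ (k, l)" using S blk_entry by simp
        qed (use S car' in auto)
      qed
    qed
    then show ?thesis using car by (simp add: bex_simps) blast
  qed
  have "{Q * M * P | M. M \<in> L} = {S \<in> carrier_mat (sum_list ns) (sum_list ns).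
      (\<forall>i<t. \<forall>j<i. \<forall>r<V.mult (\<alpha> i). \<forall>s<V.mult (\<alpha> j). S $$ (blk_start ns i + r, blk_start ns j + s) = 0) \<and>
      (\<forall>i<t. \<forall>j<t. \<alpha> i = \<alpha> j \<longrightarrow> (\<forall>r<V.mult (\<alpha> i). \<forall>s<V.mult (\<alpha> i).
        S $$ (blk_start ns i + r, blk_start ns i + s) = S $$ (blk_start ns j + r, blk_start ns j + s))) \<and>
      (\<forall>a\<in>\<rho> ` F. \<forall>b\<in>\<rho> ` F. \<forall>k\<in>set (eqs a b). \<forall>r<V.mult a. \<forall>s<V.mult b.
        (\<Sum>(i, j)\<in>V.pairs a b. k (i, j) * S $$ (blk_start ns i + r, blk_start ns j + s)) = 0)}"
    (is "_ = ?red")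
  proof (rule Set.set_eqI)
    fix S
    show "S \<in> {Q * M * P | M. M \<in> L} \<longleftrightarrow> S \<in> ?red"
      unfolding mem eqs[of "\<lambda>i r j s. S $$ (blk_start ns i + r, blk_start ns j + s)"]
      using N by (simp add: N_def)
  qed
  then have "reduced_algebra ns {Q * M * P | M. M \<in> L}"
    unfolding ns_def V.pairs_def
    by (rule reduced_algebraI[where mult = V.mult and \<alpha> = \<alpha> and A = "\<rho> ` F" and eqs = eqs, rotated])
       (rule V.\<alpha>_in_A)
  then show ?thesis
    using PQ_car PQ QP unfolding reduced_matrix_algebra_def by blast
qed

end
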